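(* Let $\mathbb{K}=\{K_t\}_{t\in[0,\infty)}$ be a filtration of a finite simplicial complex $K$ with $K=\bigcup_{t\ge0}K_t$, let $q\ge0$ be an integer, and let $r,s\in[0,\infty)$ be arbitrary (the case $r>s$ is allowed). Then $$\beta_q^{r,s}(\mathbb{K})=\xi_{\mathrm{Ver},q}(\mathcal{C}(\mathbb{K}))\big([0,r]\times(s,\infty]\big).$$
   Context: **Filtrations.** A filtration $\mathbb{K}=\{K_t\}_{t\in[0,\infty)}$ of a simplicial complex $K$ is a family of subcomplexes with $K_r\subset K_s\subset K$ for $r\le s$ and $K_r=\bigcap_{s>r}K_s$ for all $r$. Fix a coefficient field $\mathbb{F}$. **Extended persistent Betti number.** For any $r,s\in[0,\infty)$ (no order required), $$\beta_q^{r,s}(\mathbb{K}):=\dim\frac{\mathcal{Z}_q(K_r)}{\mathcal{Z}_q(K_r)\cap\mathcal{B}_q(K_s)},$$ where $\mathcal{Z}_q(\cdot)$ and $\mathcal{B}_q(\cdot)$ are the spaces of simplicial $q$-cycles and $q$-boundaries over $\mathbb{F}$, viewed inside the $q$-chains of $K$. **Verbose diagram.** Let $(C_*(K),\partial)$ be the (unreduced) simplicial chain complex of $K$ over $\mathbb{F}$. For a chain $x=\sum_i\lambda_i\sigma_i$ (distinct simplices) put $\ell_{\mathbb{K}}(x)=\max\{t_{\mathbb{K}}(\sigma_i):\lambda_i\ne0\}$, $\ell_{\mathbb{K}}(0)=-\infty$, where $t_{\mathbb{K}}(\sigma)=\inf\{t\ge0:\sigma\in K_t\}$; $\mathcal{C}(\mathbb{K})=(C_*(K),\partial,\ell_{\mathbb{K}})$.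 A finite set $\{x_1,\dots,x_k\}$ of chains is orthogonal if $\ell_{\mathbb{K}}(\sum\lambda_ix_i)=\max\{\ell_{\mathbb{K}}(x_i):\lambda_i\ne0\}$ for all $\lambda_i\in\mathbb{F}$ (with $\max\varnothing=-\infty$). View $\partial_{q+1}$ as a map $C_{q+1}(K)\to\mathrm{Ker}\,\partial_q$, of rank $\varrho$. A singular value decomposition of $\partial_{q+1}$ is a pair $((y_1,\dots,y_n),(x_1,\dots,x_m))$ of ordered orthogonal bases of $C_{q+1}(K)$ and $\mathrm{Ker}\,\partial_q$ such that $(y_{\varrho+1},\dots,y_n)$ is an orthogonal basis of $\mathrm{Ker}\,\partial_{q+1}$, $(x_1,\dots,x_\varrho)$ is an orthogonal basis of $\mathrm{Im}\,\partial_{q+1}$, and $\partial_{q+1}y_i=x_i$ for $i\le\varrho$; one always exists. The degree-$q$ verbose diagram $D_{\mathrm{Ver},q}(\mathcal{C}(\mathbb{K}))$ is the multiset consisting of $(\ell_{\mathbb{K}}(x_i),\ell_{\mathbb{K}}(y_i))$ for $i\le\varrho$ and $(\ell_{\mathbb{K}}(x_i),\infty)$ for $\varrho<i\le m$; it does not depend on the decomposition chosen. It is a multiset in $\Delta':=\{(x,y)\in[0,\infty]^2:x\le y\}\setminus\{(\infty,\infty)\}$. $\xi_{\mathrm{Ver},q}(\mathcal{C}(\mathbb{K}))$ is the measure $\sum_p\delta_p$ over the points $p$ of this multiset (with multiplicity); for $B\subset[0,\infty]^2$ its value on $B$ means its value on $B\cap\Delta'$. *)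

theory Defs
  imports
    "HOL-Analysis.Analysis"
    "HOL-Library.Poly_Mapping"
    "HOL-Library.Multiset"
    "Jordan_Normal_Form.VS_Connect"
begin

section \<open>Abstract simplicial complexes and filtrations\<close>

text \<open>The empty complex is allowed; in particular early members of a filtration may be empty.\<close>

definition abstract_simplicial_complex :: "'a set set \<Rightarrow> bool" where
  "abstract_simplicial_complex K \<longleftrightarrow>
     (\<forall>\<sigma>\<in>K. finite \<sigma> \<and> \<sigma> \<noteq> {} \<and> (\<forall>\<tau>. \<tau> \<subseteq> \<sigma> \<and> \<tau> \<noteq> {} \<longrightarrow> \<tau> \<in> K))"

definition subcomplex :: "'a set set \<Rightarrow> 'a set set \<Rightarrow> bool" where
  "subcomplex L K \<longleftrightarrow> abstract_simplicial_complex L \<and> L \<subseteq> K"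

text \<open>The index set is \<open>[0,\<infinity>)\<close>; the values of \<open>\<K>\<close> at negative reals are irrelevant.\<close>

definition simplicial_filtration :: "'a set set \<Rightarrow> (real \<Rightarrow> 'a set set) \<Rightarrow> bool" where
  "simplicial_filtration K \<K> \<longleftrightarrow>
     (\<forall>t\<ge>0. subcomplex (\<K> t) K) \<and>
     (\<forall>r s. 0 \<le> r \<and> r \<le> s \<longrightarrow> \<K> r \<subseteq> \<K> s) \<and>
     (\<forall>r\<ge>0. \<K> r = (\<Inter>s\<in>{r<..}. \<K> s))"

section \<open>Simplicial chains over a field\<close>

text \<open>
  A chain is a finitely supported function from simplices to the field \<open>'f\<close>;
  \<open>Poly_Mapping.keys x\<close> is the set of simplices with non-zero coefficient. Simplices
  are oriented by the linear order of the vertex type.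
\<close>

definition chain_scale :: "'f::field \<Rightarrow> ('s \<Rightarrow>\<^sub>0 'f) \<Rightarrow> ('s \<Rightarrow>\<^sub>0 'f)" where
  "chain_scale c x = Poly_Mapping.map ((*) c) x"

lemma lookup_chain_scale: "Poly_Mapping.lookup (chain_scale c x) k = c * Poly_Mapping.lookup x k"
  by (simp add: chain_scale_def map.rep_eq when_def)

global_interpretation chain: vector_space "chain_scale :: 'f::field \<Rightarrow> ('s \<Rightarrow>\<^sub>0 'f) \<Rightarrow> _"
  by unfold_locales
    (auto intro!: poly_mapping_eqI simp: lookup_chain_scale lookup_add algebra_simps)

definition chains :: "'a set set \<Rightarrow> nat \<Rightarrow> ('a set \<Rightarrow>\<^sub>0 'f::field) set" where
  "chains K q = {x. Poly_Mapping.keys x \<subseteq> {\<sigma> \<in> K. card \<sigma> = q + 1}}"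

text \<open>
  For \<open>\<sigma> = {v\<^sub>0 < \<dots> < v\<^sub>q}\<close> this is \<open>\<Sum>i\<le>q. (-1)^i (\<sigma> - {v\<^sub>i})\<close>, since \<open>i\<close> is the number
  of vertices below \<open>v\<^sub>i\<close>. The complex is unreduced: vertices have boundary \<open>0\<close>.
\<close>

definition simplex_boundary :: "'a::linorder set \<Rightarrow> ('a set \<Rightarrow>\<^sub>0 'f::field)" where
  "simplex_boundary \<sigma> =
     (if card \<sigma> \<le> 1 then 0
      else \<Sum>v\<in>\<sigma>. Poly_Mapping.single (\<sigma> - {v}) ((- 1) ^ card {w \<in> \<sigma>. w < v}))"

definition boundary :: "('a::linorder set \<Rightarrow>\<^sub>0 'f::field) \<Rightarrow> ('a set \<Rightarrow>\<^sub>0 'f)" where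
  "boundary x = (\<Sum>\<sigma>\<in>Poly_Mapping.keys x. chain_scale (Poly_Mapping.lookup x \<sigma>) (simplex_boundary \<sigma>))"

definition cycles :: "'a::linorder set set \<Rightarrow> nat \<Rightarrow> ('a set \<Rightarrow>\<^sub>0 'f::field) set" where
  "cycles K q = {x \<in> chains K q. boundary x = 0}"

definition boundaries :: "'a::linorder set set \<Rightarrow> nat \<Rightarrow> ('a set \<Rightarrow>\<^sub>0 'f::field) set" where
  "boundaries K q = boundary ` chains K (q + 1)"

section \<open>The extended persistent Betti number\<close>

text \<open>
  The cosets of \<open>W\<close> in \<open>V\<close> with the induced operations. Adding \<open>W\<close> in \<open>smult\<close> only matters
  for the scalar \<open>0\<close>, where \<open>{0 * a | a \<in> A}\<close> is not a whole coset. The multiplicative fields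
  belong to the record type and play no role for modules.
\<close>

definition quotient_space ::
    "('s \<Rightarrow>\<^sub>0 'f::field) set \<Rightarrow> ('s \<Rightarrow>\<^sub>0 'f) set \<Rightarrow> ('f, ('s \<Rightarrow>\<^sub>0 'f) set) module" where
  "quotient_space V W =
     \<lparr>carrier = (\<lambda>v. (+) v ` W) ` V, mult = undefined, one = undefined,
      zero = W, add = (\<lambda>A B. {a + b | a b. a \<in> A \<and> b \<in> B}),
      smult = (\<lambda>c A. {chain_scale c a + w | a w. a \<in> A \<and> w \<in> W})\<rparr>"

context
  fixes V W :: "('s \<Rightarrow>\<^sub>0 'f::field) set"
  assumes V: "chain.subspace V" and W: "chain.subspace W" and WV: "W \<subseteq> V"
begin

lemma quotient_space_add:
  "add (quotient_space V W) ((+) u ` W) ((+) v ` W) = (+) (u + v) ` W"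
proof -
  have "{a + b | a b. a \<in> (+) u ` W \<and> b \<in> (+) v ` W} = (+) (u + v) ` W"
  proof (intro equalityI subsetI)
    fix x assume "x \<in> {a + b | a b. a \<in> (+) u ` W \<and> b \<in> (+) v ` W}"
    then obtain w w' where w: "w \<in> W" "w' \<in> W" and x: "x = (u + w) + (v + w')"
      by blast
    have "x = (u + v) + (w + w')" using x by (simp add: ac_simps)
    then show "x \<in> (+) (u + v) ` W" using chain.subspace_add[OF W w] by (rule image_eqI)
  next
    fix x assume "x \<in> (+) (u + v) ` W"
    then obtain w where w: "w \<in> W" and "x = (u + v) + w" by blast
    then have "x = (u + w) + (v + 0)" by (simp add: ac_simps)
    then show "x \<in> {a + b | a b. a \<in> (+) u ` W \<and> b \<in> (+) v ` W}"
      using w chain.subspace_0[OF W] by blast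
  qed
  then show ?thesis by (simp add: quotient_space_def)
qed

lemma quotient_space_smult:
  "smult (quotient_space V W) c ((+) v ` W) = (+) (chain_scale c v) ` W"
proof -
  have "{chain_scale c a + w | a w. a \<in> (+) v ` W \<and> w \<in> W} = (+) (chain_scale c v) ` W"
  proof (intro equalityI subsetI)
    fix x assume "x \<in> {chain_scale c a + w | a w. a \<in> (+) v ` W \<and> w \<in> W}"
    then obtain w w' where w: "w \<in> W" "w' \<in> W" and x: "x = chain_scale c (v + w) + w'"
      by blast
    have "x = chain_scale c v + (chain_scale c w + w')"
      using x by (simp add: chain.scale_right_distrib ac_simps)
    then show "x \<in> (+) (chain_scale c v) ` W"
      using chain.subspace_add[OF W chain.subspace_scale[OF W w(1)] w(2)] by (rule image_eqI)
  next
    fix x assume "x \<in> (+) (chain_scale c v) ` W"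
    then obtain w where w: "w \<in> W" and "x = chain_scale c v + w" by blast
    then have "x = chain_scale c (v + 0) + w" by simp
    then show "x \<in> {chain_scale c a + w | a w. a \<in> (+) v ` W \<and> w \<in> W}"
      using w chain.subspace_0[OF W] by blast
  qed
  then show ?thesis by (simp add: quotient_space_def)
qed

lemma vectorspace_quotient_space: "vectorspace class_ring (quotient_space V W)"
proof -
  let ?Q = "quotient_space V W"
  have carr: "carrier ?Q = (\<lambda>v. (+) v ` W) ` V" and zero: "zero ?Q = (+) 0 ` W"
    by (simp_all add: quotient_space_def)
  note add = quotient_space_add and smult = quotient_space_smult
  have field: "field (class_ring :: 'f ring)"
    by (rule class_field)
  have mem: "(+) v ` W \<in> carrier ?Q" if "v \<in> V" for v
    using that carr by blast
  have ex: "\<exists>v\<in>V. A = (+) v ` W" if "A \<in> carrier ?Q" for A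
    using that carr by blast
  have grp: "abelian_group ?Q"
  proof (rule abelian_groupI)
    fix A B assume "A \<in> carrier ?Q" "B \<in> carrier ?Q"
    then obtain u v where uv: "u \<in> V" "v \<in> V" and AB: "A = (+) u ` W" "B = (+) v ` W"
      using ex by blast
    show "add ?Q A B \<in> carrier ?Q"
      unfolding AB add by (rule mem[OF chain.subspace_add[OF V uv]])
    show "add ?Q A B = add ?Q B A"
      unfolding AB add by (simp only: add.commute)
    show "add ?Q (zero ?Q) A = A"
      unfolding AB zero add by simp
    have "add ?Q ((+) (- u) ` W) A = zero ?Q"
      unfolding AB zero add by simp
    then show "\<exists>C\<in>carrier ?Q. add ?Q C A = zero ?Q"
      using mem[OF chain.subspace_neg[OF V uv(1)]] by blast
    fix C assume "C \<in> carrier ?Q"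
    then obtain w where C: "C = (+) w ` W"
      using ex by blast
    show "add ?Q (add ?Q A B) C = add ?Q A (add ?Q B C)"
      unfolding AB C add by (simp only: add.assoc)
  next
    show "zero ?Q \<in> carrier ?Q"
      unfolding zero by (rule mem[OF chain.subspace_0[OF V]])
  qed
  have "module class_ring ?Q"
  proof (rule moduleI[OF _ grp])
    show "cring (class_ring :: 'f ring)"
      using field by (simp add: field_def domain_def)
  next
    fix a b :: 'f and A B
    assume "A \<in> carrier ?Q" "B \<in> carrier ?Q"
    then obtain u v where uv: "u \<in> V" "v \<in> V" and AB: "A = (+) u ` W" "B = (+) v ` W"
      using ex by blast
    show "smult ?Q a A \<in> carrier ?Q"
      unfolding AB smult by (rule mem[OF chain.subspace_scale[OF V uv(1)]])
    show "smult ?Q (add class_ring a b) A = add ?Q (smult ?Q a A) (smult ?Q b A)"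
      unfolding AB add smult by (simp add: chain.scale_left_distrib)
    show "smult ?Q a (add ?Q A B) = add ?Q (smult ?Q a A) (smult ?Q a B)"
      unfolding AB add smult by (simp add: chain.scale_right_distrib)
    show "smult ?Q (mult class_ring a b) A = smult ?Q a (smult ?Q b A)"
      unfolding AB smult by simp
    show "smult ?Q (one class_ring) A = A"
      unfolding AB smult by simp
  qed
  then show ?thesis
    using field by (simp add: vectorspace_def)
qed

end

definition persistent_betti ::
    "'f::field itself \<Rightarrow> (real \<Rightarrow> 'a::linorder set set) \<Rightarrow> nat \<Rightarrow> real \<Rightarrow> real \<Rightarrow> nat" where
  "persistent_betti F \<K> q r s =
     vectorspace.dim (class_ring :: 'f ring)
       (quotient_space (cycles (\<K> r) q) (cycles (\<K> r) q \<inter> boundaries (\<K> s) q))"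

section \<open>The verbose diagram\<close>

definition entry_time :: "(real \<Rightarrow> 'a set set) \<Rightarrow> 'a set \<Rightarrow> ereal" where
  "entry_time \<K> \<sigma> = Inf {ereal t | t. 0 \<le> t \<and> \<sigma> \<in> \<K> t}"

definition max_or_minf :: "ereal set \<Rightarrow> ereal" where
  "max_or_minf A = (if A = {} then - \<infinity> else Max A)"

definition chain_level :: "(real \<Rightarrow> 'a set set) \<Rightarrow> ('a set \<Rightarrow>\<^sub>0 'f::field) \<Rightarrow> ereal" where
  "chain_level \<K> x = max_or_minf (entry_time \<K> ` Poly_Mapping.keys x)"

definition orthogonal_chains :: "(real \<Rightarrow> 'a set set) \<Rightarrow> ('a set \<Rightarrow>\<^sub>0 'f::field) set \<Rightarrow> bool" where
  "orthogonal_chains \<K> X \<longleftrightarrow> finite X \<and>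
     (\<forall>c. chain_level \<K> (\<Sum>x\<in>X. chain_scale (c x) x)
            = max_or_minf (chain_level \<K> ` {x \<in> X. c x \<noteq> 0}))"

definition orthogonal_basis ::
    "(real \<Rightarrow> 'a set set) \<Rightarrow> ('a set \<Rightarrow>\<^sub>0 'f::field) set \<Rightarrow> ('a set \<Rightarrow>\<^sub>0 'f) list \<Rightarrow> bool" where
  "orthogonal_basis \<K> V xs \<longleftrightarrow>
     distinct xs \<and> chain.independent (set xs) \<and> chain.span (set xs) = V \<and>
     orthogonal_chains \<K> (set xs)"

definition boundary_rank :: "'f::field itself \<Rightarrow> 'a::linorder set set \<Rightarrow> nat \<Rightarrow> nat" where
  "boundary_rank F K q = chain.dim (boundaries K q :: ('a set \<Rightarrow>\<^sub>0 'f) set)"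

text \<open>
  The operator is \<open>\<partial>\<^sub>q\<^sub>+\<^sub>1\<close>, from \<open>(q + 1)\<close>-chains to \<open>q\<close>-cycles. Lists are indexed from \<open>0\<close>, so
  \<open>take \<rho>\<close> and \<open>drop \<rho>\<close> split a basis after its \<open>\<rho>\<close>-th element.
\<close>

definition singular_value_decomposition ::
    "'a::linorder set set \<Rightarrow> (real \<Rightarrow> 'a set set) \<Rightarrow> nat
      \<Rightarrow> ('a set \<Rightarrow>\<^sub>0 'f::field) list \<Rightarrow> ('a set \<Rightarrow>\<^sub>0 'f) list \<Rightarrow> bool" where
  "singular_value_decomposition K \<K> q ys xs \<longleftrightarrow>
     (let \<rho> = boundary_rank TYPE('f) K q in
        orthogonal_basis \<K> (chains K (q + 1)) ys \<and>
        orthogonal_basis \<K> (cycles K q) xs \<and>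
        orthogonal_basis \<K> (cycles K (q + 1)) (drop \<rho> ys) \<and>
        orthogonal_basis \<K> (boundaries K q) (take \<rho> xs) \<and>
        (\<forall>i<\<rho>. boundary (ys ! i) = xs ! i))"

definition svd_diagram ::
    "'a::linorder set set \<Rightarrow> (real \<Rightarrow> 'a set set) \<Rightarrow> nat
      \<Rightarrow> ('a set \<Rightarrow>\<^sub>0 'f::field) list \<Rightarrow> ('a set \<Rightarrow>\<^sub>0 'f) list \<Rightarrow> (ereal \<times> ereal) multiset" where
  "svd_diagram K \<K> q ys xs =
     mset (map (\<lambda>i. (chain_level \<K> (xs ! i),
                     if i < boundary_rank TYPE('f) K q then chain_level \<K> (ys ! i) else \<infinity>))
             [0..<length xs])"

text \<open>
  The multiset does not depend on the decomposition, so the definite description picks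
  the common value of all decompositions.
\<close>

definition verbose_diagram ::
    "'f::field itself \<Rightarrow> 'a::linorder set set \<Rightarrow> (real \<Rightarrow> 'a set set) \<Rightarrow> nat
      \<Rightarrow> (ereal \<times> ereal) multiset" where
  "verbose_diagram F K \<K> q =
     (THE D. \<exists>ys xs :: ('a set \<Rightarrow>\<^sub>0 'f) list.
        singular_value_decomposition K \<K> q ys xs \<and> D = svd_diagram K \<K> q ys xs)"

definition Delta' :: "(ereal \<times> ereal) set" where
  "Delta' = {(x, y). 0 \<le> x \<and> x \<le> y} - {(\<infinity>, \<infinity>)}"

text \<open>The sum of Dirac measures, as a Borel measure on \<open>Delta'\<close>.\<close>

definition verbose_measure ::
    "'f::field itself \<Rightarrow> 'a::linorder set set \<Rightarrow> (real \<Rightarrow> 'a set set) \<Rightarrow> nat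
      \<Rightarrow> (ereal \<times> ereal) measure" where
  "verbose_measure F K \<K> q =
     measure_of Delta' (sets (restrict_space borel Delta'))
       (\<lambda>B. \<Sum>p\<in>#verbose_diagram F K \<K> q. indicator B p)"

end

theory Submission
  imports Defs
begin

text \<open>
  For a decomposition \<open>(ys, xs)\<close>, orthogonality says that a chain lies in a sublevel space iff
  all basis elements occurring in it do. Hence the cycles of \<open>K\<^sub>r\<close> have as basis the \<open>x\<^sub>i\<close>
  of level at most \<open>r\<close>, the boundaries of \<open>K\<^sub>s\<close> have as basis the \<open>x\<^sub>i = \<partial>y\<^sub>i\<close> with \<open>y\<^sub>i\<close>
  of level at most \<open>s\<close>, and the quotient has dimension the number of points in the quadrant.
  The same count for arbitrary down-sets of levels does not mention the decomposition and
  determines the multiset of points, so the diagram is well defined.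

  Existence: order the simplices compatibly with entry times. Chains with distinct leading
  simplices are independent and orthogonal. For each leading simplex \<open>b\<close> of a boundary choose
  \<open>y\<^sub>b\<close> with \<open>\<partial>y\<^sub>b\<close> led by \<open>b\<close> and with the smallest possible leading simplex; by minimality
  the leading simplices of the \<open>y\<^sub>b\<close> are distinct, and different from those of cycles.
\<close>

section \<open>The boundary operator\<close>

text \<open>Simplices outside the support have coefficient 0. Enlarging the index set lets the
  boundaries of two chains be summed over a common set, which additivity needs.\<close>

lemma boundary_eq_sum:
  assumes "finite S" "Poly_Mapping.keys x \<subseteq> S"
  shows "boundary x = (\<Sum>\<sigma>\<in>S. chain_scale (Poly_Mapping.lookup x \<sigma>) (simplex_boundary \<sigma>))"
  unfolding boundary_def
  by (rule sum.mono_neutral_left) (use assms in \<open>auto simp: in_keys_iff\<close>)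

lemma chain_scale_single: "chain_scale c (Poly_Mapping.single k d) = Poly_Mapping.single k (c * d)"
  by (simp add: chain_scale_def)

lemma keys_chain_scale: "Poly_Mapping.keys (chain_scale c x) \<subseteq> Poly_Mapping.keys x"
  by (auto simp: in_keys_iff lookup_chain_scale)

global_interpretation boundary: Vector_Spaces.linear
  "chain_scale :: 'f::field \<Rightarrow> ('a::linorder set \<Rightarrow>\<^sub>0 'f) \<Rightarrow> _"
  "chain_scale :: 'f \<Rightarrow> ('a set \<Rightarrow>\<^sub>0 'f) \<Rightarrow> _" boundary
proof unfold_locales
  fix x y :: "'a set \<Rightarrow>\<^sub>0 'f" and c
  let ?S = "Poly_Mapping.keys x \<union> Poly_Mapping.keys y"
  have "boundary (x + y) = (\<Sum>\<sigma>\<in>?S. chain_scale (Poly_Mapping.lookup (x + y) \<sigma>) (simplex_boundary \<sigma>))"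
    by (rule boundary_eq_sum) (use keys_add[of x y] in auto)
  also have "\<dots> = boundary x + boundary y"
    by (simp add: boundary_eq_sum[of ?S x] boundary_eq_sum[of ?S y] lookup_add
        chain.scale_left_distrib sum.distrib)
  finally show "boundary (x + y) = boundary x + boundary y" .
  show "boundary (chain_scale c x) = chain_scale c (boundary x)"
    using keys_chain_scale[of c x]
    by (simp add: boundary_eq_sum[of "Poly_Mapping.keys x"] lookup_chain_scale chain.scale_sum_right)
qed

lemma keys_simplex_boundary:
  "Poly_Mapping.keys (simplex_boundary \<sigma>) \<subseteq> {\<sigma> - {v} | v. v \<in> \<sigma> \<and> 1 < card \<sigma>}"
proof (cases "card \<sigma> \<le> 1")
  case False
  have "Poly_Mapping.keys (simplex_boundary \<sigma> :: _ \<Rightarrow>\<^sub>0 'b) \<subseteq> (\<Union>v\<in>\<sigma>. {\<sigma> - {v}})"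
    using False unfolding simplex_boundary_def
    by (auto simp del: UN_simps intro!: keys_sum[THEN order_trans] UN_mono)
  then show ?thesis using False by auto
qed (simp add: simplex_boundary_def)

lemma keys_boundary:
  assumes "\<tau> \<in> Poly_Mapping.keys (boundary x)"
  obtains \<sigma> v where "\<sigma> \<in> Poly_Mapping.keys x" "v \<in> \<sigma>" "1 < card \<sigma>" "\<tau> = \<sigma> - {v}"
proof -
  from assms obtain \<sigma> where "\<sigma> \<in> Poly_Mapping.keys x" "\<tau> \<in> Poly_Mapping.keys (simplex_boundary \<sigma> :: _ \<Rightarrow>\<^sub>0 'b)"
    unfolding boundary_def using keys_sum keys_chain_scale by fastforce
  with keys_simplex_boundary[where 'b='b] that show thesis by blast
qed

section \<open>The square of the boundary operator\<close>

lemma boundary_single: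
  "boundary (Poly_Mapping.single \<sigma> c) = chain_scale c (simplex_boundary \<sigma>)"
  by (cases "c = 0") (simp_all add: boundary_def)

text \<open>Exchanging the two summations turns the terms with \<open>w < v\<close> into those with
  \<open>v < w\<close>, where each pair cancels. Nothing is divided by 2, so this works in every
  characteristic.\<close>

lemma sum_offdiagonal_antisym:
  fixes g :: "'a::linorder \<Rightarrow> 'a \<Rightarrow> 'b::ab_group_add"
  assumes A: "finite A" and g: "\<And>v w. v \<in> A \<Longrightarrow> w \<in> A \<Longrightarrow> v < w \<Longrightarrow> g v w + g w v = 0"
  shows "(\<Sum>v\<in>A. \<Sum>w\<in>A - {v}. g v w) = 0"
proof -
  have split: "A - {v} = {w\<in>A. w < v} \<union> {w\<in>A. v < w}" for v by auto
  have "(\<Sum>v\<in>A. \<Sum>w\<in>A - {v}. g v w) = (\<Sum>v\<in>A. \<Sum>w | w \<in> A \<and> w < v. g v w) + (\<Sum>v\<in>A. \<Sum>w | w \<in> A \<and> v < w. g v w)"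
    unfolding split by (subst sum.union_disjoint) (use A in \<open>auto simp: sum.distrib\<close>)
  also have "(\<Sum>v\<in>A. \<Sum>w | w \<in> A \<and> w < v. g v w) = (\<Sum>v\<in>A. \<Sum>w | w \<in> A \<and> v < w. g w v)"
    by (rule sum.swap_restrict[OF A A])
  also have "\<dots> + (\<Sum>v\<in>A. \<Sum>w | w \<in> A \<and> v < w. g v w) = (\<Sum>v\<in>A. \<Sum>w | w \<in> A \<and> v < w. g w v + g v w)"
    by (simp add: sum.distrib)
  also have "\<dots> = 0"
    using g by (intro sum.neutral ballI) (auto simp: add.commute)
  finally show ?thesis .
qed

text \<open>Deleting two vertices in either order gives the same face with opposite signs. At most
  two vertices form a separate case: the complex is unreduced, so all faces that occur there have
  boundary 0 by definition, not by cancellation.\<close>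

lemma boundary_simplex_boundary: "boundary (simplex_boundary \<sigma> :: _ \<Rightarrow>\<^sub>0 'f::field) = 0"
proof (cases "card \<sigma> \<le> 2")
  case True
  have "boundary (simplex_boundary \<sigma> :: _ \<Rightarrow>\<^sub>0 'f) =
      (\<Sum>\<tau>\<in>Poly_Mapping.keys (simplex_boundary \<sigma> :: _ \<Rightarrow>\<^sub>0 'f). 0)"
    unfolding boundary_def
  proof (rule sum.cong[OF refl])
    fix \<tau> assume "\<tau> \<in> Poly_Mapping.keys (simplex_boundary \<sigma> :: _ \<Rightarrow>\<^sub>0 'f)"
    then obtain v where "v \<in> \<sigma>" "1 < card \<sigma>" "\<tau> = \<sigma> - {v}"
      using keys_simplex_boundary by blast
    then have "card \<tau> \<le> 1"
      using True by simp
    then show "chain_scale (Poly_Mapping.lookup (simplex_boundary \<sigma>) \<tau>) (simplex_boundary \<tau>) = (0 :: _ \<Rightarrow>\<^sub>0 'f)"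
      by (simp add: simplex_boundary_def)
  qed
  then show ?thesis by simp
next
  case False
  \<comment> \<open>An infinite set has \<open>card\<close> 0, so it falls under the other
    case.\<close>
  then have fin: "finite \<sigma>" by (intro card_ge_0_finite) auto
  define pos where "pos \<sigma> v = card {w \<in> \<sigma>. w < v}" for \<sigma> and v :: 'a
  define g :: "'a \<Rightarrow> 'a \<Rightarrow> 'a set \<Rightarrow>\<^sub>0 'f" where
    "g v w = Poly_Mapping.single (\<sigma> - {v} - {w}) ((- 1) ^ pos \<sigma> v * (- 1) ^ pos (\<sigma> - {v}) w)" for v w
  have "boundary (simplex_boundary \<sigma> :: _ \<Rightarrow>\<^sub>0 'f) =
      (\<Sum>v\<in>\<sigma>. chain_scale ((- 1) ^ pos \<sigma> v) (simplex_boundary (\<sigma> - {v})))"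
    using False by (simp add: simplex_boundary_def[of \<sigma>] boundary.sum boundary_single pos_def)
  also have "\<dots> = (\<Sum>v\<in>\<sigma>. \<Sum>w\<in>\<sigma> - {v}. g v w)"
  proof (rule sum.cong[OF refl])
    fix v assume "v \<in> \<sigma>"
    then have "\<not> card (\<sigma> - {v}) \<le> 1" using False fin by simp
    then show "chain_scale ((- 1) ^ pos \<sigma> v) (simplex_boundary (\<sigma> - {v})) = (\<Sum>w\<in>\<sigma> - {v}. g v w)"
      unfolding simplex_boundary_def[of "\<sigma> - {v}"]
      by (simp add: chain.scale_sum_right g_def pos_def chain_scale_single)
  qed
  also have "\<dots> = 0"
  proof (rule sum_offdiagonal_antisym[OF fin])
    fix v w assume vw: "v \<in> \<sigma>" "w \<in> \<sigma>" "v < w"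
    \<comment> \<open>The source of the opposite signs: deleting the larger vertex \<open>w\<close>
      keeps the position of \<open>v\<close>, deleting the smaller vertex \<open>v\<close> lowers
      the position of \<open>w\<close> by one.\<close>
    have "{u \<in> \<sigma> - {w}. u < v} = {u \<in> \<sigma>. u < v}" using vw by auto
    then have 1: "pos (\<sigma> - {w}) v = pos \<sigma> v" by (simp add: pos_def)
    have "{u \<in> \<sigma>. u < w} = insert v {u \<in> \<sigma> - {v}. u < w}" using vw by auto
    then have 2: "pos \<sigma> w = Suc (pos (\<sigma> - {v}) w)" using fin by (simp add: pos_def)
    have "\<sigma> - {w} - {v} = \<sigma> - {v} - {w}" by auto
    then show "g v w + g w v = 0"
      by (simp add: g_def 1 2 flip: single_add)
  qed
  finally show ?thesis .
qed

lemma boundary_boundary: "boundary (boundary x) = 0"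
  unfolding boundary_def[of x] by (simp add: boundary.sum boundary.scale boundary_simplex_boundary)

section \<open>Dimensions of quotients\<close>

lemma coset_eq_iff:
  fixes W :: "('s \<Rightarrow>\<^sub>0 'f::field) set"
  assumes W: "chain.subspace W"
  shows "(+) u ` W = (+) v ` W \<longleftrightarrow> u - v \<in> W"
proof
  assume "(+) u ` W = (+) v ` W"
  moreover have "u \<in> (+) u ` W"
    using chain.subspace_0[OF W] by (force simp: image_iff)
  ultimately obtain w where "w \<in> W" "u = v + w" by blast
  then show "u - v \<in> W" by simp
next
  assume uv: "u - v \<in> W"
  show "(+) u ` W = (+) v ` W"
  proof (intro equalityI image_subsetI)
    fix w assume w: "w \<in> W"
    show "u + w \<in> (+) v ` W"
      using chain.subspace_add[OF W uv w] by (rule rev_image_eqI) simp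
    show "v + w \<in> (+) u ` W"
      using chain.subspace_diff[OF W w uv] by (rule rev_image_eqI) simp
  qed
qed

text \<open>The cosets of the elements of \<open>X - Y\<close> form a basis: they span because
  \<open>Y\<close> becomes zero, and a relation among them modulo the span of \<open>Y\<close> would
  put some \<open>x\<close> into the span of \<open>X - {x}\<close>.\<close>

lemma dim_quotient_space:
  fixes X :: "('s \<Rightarrow>\<^sub>0 'f::field) set"
  assumes fin: "finite X" and ind: "chain.independent X" and YX: "Y \<subseteq> X"
  shows "vectorspace.dim class_ring (quotient_space (chain.span X) (chain.span Y)) = card (X - Y)"
proof -
  let ?V = "chain.span X" and ?W = "chain.span Y"
  let ?Q = "quotient_space ?V ?W"
  define q where "q v = (+) v ` ?W" for v
  note sub = chain.subspace_span[of X] chain.subspace_span[of Y] chain.span_mono[OF YX]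
  interpret Q: vectorspace class_ring ?Q
    by (rule vectorspace_quotient_space[OF sub])
  have carrier: "carrier ?Q = q ` ?V" and zero: "zero ?Q = q 0"
    by (simp_all add: quotient_space_def q_def)
  have add: "add ?Q (q u) (q v) = q (u + v)" for u v
    unfolding q_def by (rule quotient_space_add[OF sub])
  have smult: "smult ?Q c (q v) = q (chain_scale c v)" for c v
    unfolding q_def by (rule quotient_space_smult[OF sub])
  have q_eq: "q u = q v \<longleftrightarrow> u - v \<in> ?W" for u v
    unfolding q_def by (rule coset_eq_iff[OF sub(2)])
  \<comment> \<open>The projection commutes with finite sums. This carries computations in the
    record structure of the quotient back to ordinary sums of chains.\<close>
  have finsum: "finsum ?Q (\<lambda>x. q (f x)) A = q (sum f A)"
    if "finite A" "f ` A \<subseteq> ?V" for f :: "('s \<Rightarrow>\<^sub>0 'f) \<Rightarrow> _" and A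
    using that
  proof (induction A)
    case (insert x A)
    have "finsum ?Q (\<lambda>x. q (f x)) (insert x A) = add ?Q (q (f x)) (finsum ?Q (\<lambda>x. q (f x)) A)"
      by (rule Q.finsum_insert) (use insert in \<open>auto simp: carrier\<close>)
    with insert show ?case by (simp add: add)
  qed (simp add: zero)
  have not_span: "x \<notin> chain.span (X - {x})" if "x \<in> X" for x
    using ind that chain.dependent_def by blast
  have inj: "inj_on q (X - Y)"
  proof (rule inj_onI, rule ccontr)
    fix x x' assume x: "x \<in> X - Y" "x' \<in> X - Y" "q x = q x'" "x \<noteq> x'"
    have "x - x' \<in> chain.span (X - {x})"
      using x YX chain.span_mono[of Y "X - {x}"] unfolding q_eq by blast
    moreover have "x' \<in> chain.span (X - {x})"
      using x by (intro chain.span_base) auto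
    ultimately have "(x - x') + x' \<in> chain.span (X - {x})"
      by (rule chain.span_add)
    with not_span x show False by simp
  qed
  have lincomb: "Q.lincomb a (q ` B) = q (\<Sum>x\<in>B. chain_scale (a (q x)) x)"
    if B: "B \<subseteq> X - Y" for a B
  proof -
    have finB: "finite B" using B fin finite_subset by blast
    have BV: "(\<lambda>x. chain_scale (a (q x)) x) ` B \<subseteq> ?V"
      using B by (auto intro: chain.span_scale chain.span_base)
    have "Q.lincomb a (q ` B) = finsum ?Q (\<lambda>x. smult ?Q (a (q x)) (q x)) B"
      unfolding Q.lincomb_def
      by (rule Q.finsum_reindex)
        (use BV in \<open>auto simp: smult carrier intro: inj_on_subset[OF inj B]\<close>)
    also have "\<dots> = q (\<Sum>x\<in>B. chain_scale (a (q x)) x)"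
      unfolding smult by (rule finsum[OF finB BV])
    finally show ?thesis .
  qed
  have basis_sub: "q ` (X - Y) \<subseteq> carrier ?Q"
    unfolding carrier by (auto intro: chain.span_base)
  have "Q.lin_indpt (q ` (X - Y))"
  proof
    assume "Q.lin_dep (q ` (X - Y))"
    then obtain A a v where A: "A \<subseteq> q ` (X - Y)" and zero': "Q.lincomb a A = zero ?Q"
      and v: "v \<in> A" and av: "a v \<noteq> 0"
      unfolding Q.lin_dep_def by auto
    from A obtain B where B: "B \<subseteq> X - Y" and AB: "A = q ` B"
      by (meson subset_imageE)
    from v AB obtain x where x: "x \<in> B" "v = q x" by blast
    have finB: "finite B" using B fin finite_subset by blast
    let ?c = "\<lambda>x. chain_scale (a (q x)) x"
    \<comment> \<open>A vanishing combination of cosets is a chain in \<open>?W\<close>. Isolating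
      its term at \<open>x\<close>, whose coefficient is non-zero, expresses \<open>x\<close> by
      other elements of \<open>X\<close>.\<close>
    have "(\<Sum>x\<in>B. ?c x) \<in> ?W"
      using zero' unfolding AB lincomb[OF B] zero q_eq by simp
    moreover have "?W \<subseteq> chain.span (X - {x})"
      using x B YX by (intro chain.span_mono) auto
    moreover have "(\<Sum>x\<in>B - {x}. ?c x) \<in> chain.span (X - {x})"
      using B by (intro chain.span_sum chain.span_scale chain.span_base) auto
    ultimately have "(\<Sum>x\<in>B. ?c x) - (\<Sum>x\<in>B - {x}. ?c x) \<in> chain.span (X - {x})"
      by (auto intro: chain.span_diff)
    then have "?c x \<in> chain.span (X - {x})"
      using x finB by (simp add: sum.remove)
    then have "chain_scale (inverse (a v)) (?c x) \<in> chain.span (X - {x})"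
      by (rule chain.span_scale)
    then have "x \<in> chain.span (X - {x})"
      using av x by simp
    with not_span x B show False by blast
  qed
  moreover have "Q.span (q ` (X - Y)) = carrier ?Q"
  proof (rule equalityI[OF Q.span_is_subset2[OF basis_sub]], rule subsetI)
    fix A assume "A \<in> carrier ?Q"
    then obtain v where "v \<in> ?V" and A: "A = q v" unfolding carrier by blast
    then obtain c where v: "v = (\<Sum>x\<in>X. chain_scale (c x) x)"
      unfolding chain.span_finite[OF fin] by blast
    \<comment> \<open>\<open>Q.lincomb\<close> wants coefficients indexed by cosets, so
      \<open>c\<close> is transported along the inverse of \<open>q\<close>, which is injective on
      \<open>X - Y\<close>.\<close>
    define a where "a = (\<lambda>A. c (inv_into (X - Y) q A))"
    have "v = (\<Sum>x\<in>X - Y. chain_scale (c x) x) + (\<Sum>x\<in>Y. chain_scale (c x) x)"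
      unfolding v by (rule sum.subset_diff[OF YX fin])
    moreover have "(\<Sum>x\<in>Y. chain_scale (c x) x) \<in> ?W"
      by (intro chain.span_sum chain.span_scale chain.span_base)
    ultimately have "A = q (\<Sum>x\<in>X - Y. chain_scale (c x) x)"
      unfolding A q_eq by simp
    also have "\<dots> = Q.lincomb a (q ` (X - Y))"
      unfolding lincomb[OF order_refl] a_def using inj by (simp add: inv_into_f_f)
    finally show "A \<in> Q.span (q ` (X - Y))"
      unfolding Q.span_def using fin by auto
  qed
  ultimately have "Q.basis (q ` (X - Y))"
    using basis_sub by (simp add: Q.basis_def)
  then have "Q.dim = card (q ` (X - Y))"
    using fin by (intro Q.dim_basis) auto
  then show ?thesis by (simp add: card_image[OF inj])
qed

section \<open>Chains with distinct leading simplices\<close>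

text \<open>A total order refining the entry times: simplices entering simultaneously get different
  indices, so every non-zero chain supported in \<open>S\<close> has a unique leading simplex, and
  this simplex has the largest entry time in the chain.\<close>

locale simplex_index =
  fixes \<K> :: "real \<Rightarrow> 'a::linorder set set" and S :: "'a set set" and idx :: "'a set \<Rightarrow> nat"
  assumes finite_S: "finite S" and inj_idx: "inj_on idx S"
    and entry_time_mono: "\<And>\<sigma> \<tau>. \<sigma> \<in> S \<Longrightarrow> \<tau> \<in> S \<Longrightarrow> idx \<sigma> \<le> idx \<tau> \<Longrightarrow> entry_time \<K> \<sigma> \<le> entry_time \<K> \<tau>"
begin

definition supported :: "('a set \<Rightarrow>\<^sub>0 'f::field) set" where
  "supported = {x. Poly_Mapping.keys x \<subseteq> S}"

text \<open>The pivot position of elimination. The value at the zero chain has no meaning, hence the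
  removal of 0 in \<open>leads\<close>.\<close>

definition lead :: "('a set \<Rightarrow>\<^sub>0 'f::field) \<Rightarrow> nat" where
  "lead x = Max (idx ` Poly_Mapping.keys x)"

definition leads :: "('a set \<Rightarrow>\<^sub>0 'f::field) set \<Rightarrow> nat set" where
  "leads V = lead ` (V - {0})"

section \<open>Gaussian elimination on leading simplices\<close>

lemma idx_le_lead: "\<sigma> \<in> Poly_Mapping.keys x \<Longrightarrow> idx \<sigma> \<le> lead x"
  by (simp add: lead_def)

lemma lead_in_keys:
  assumes "x \<noteq> 0"
  obtains \<sigma> where "\<sigma> \<in> Poly_Mapping.keys x" "idx \<sigma> = lead x"
proof -
  have "lead x \<in> idx ` Poly_Mapping.keys x"
    unfolding lead_def using assms by (intro Max_in) auto
  with that show thesis by auto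
qed

lemma finite_leads:
  assumes "V \<subseteq> supported"
  shows "finite (leads V)"
proof (rule finite_subset)
  show "leads V \<subseteq> idx ` S"
  proof
    fix l assume "l \<in> leads V"
    then obtain x where x: "x \<in> V" "x \<noteq> 0" "l = lead x" by (auto simp: leads_def)
    obtain \<sigma> where "\<sigma> \<in> Poly_Mapping.keys x" "idx \<sigma> = lead x"
      using lead_in_keys[OF x(2)] .
    then show "l \<in> idx ` S" using x assms by (intro image_eqI) (auto simp: supported_def)
  qed
qed (use finite_S in auto)

text \<open>Injectivity of \<open>idx\<close> on \<open>S\<close> makes the two leading simplices
  equal, so the quotient of their coefficients is a scalar \<open>c\<close> that cancels the leading
  term; all other simplices have smaller index.\<close>

lemma lead_cancel:
  fixes x y :: "'a set \<Rightarrow>\<^sub>0 'f::field"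
  assumes "x \<in> supported" "y \<in> supported" "x \<noteq> 0" "y \<noteq> 0" "lead x = lead y"
  obtains c where "x - chain_scale c y = 0 \<or> lead (x - chain_scale c y) < lead x"
proof -
  obtain \<sigma> where \<sigma>: "\<sigma> \<in> Poly_Mapping.keys x" "idx \<sigma> = lead x"
    using lead_in_keys[OF \<open>x \<noteq> 0\<close>] .
  obtain \<tau> where \<tau>: "\<tau> \<in> Poly_Mapping.keys y" "idx \<tau> = lead y"
    using lead_in_keys[OF \<open>y \<noteq> 0\<close>] .
  have in_S: "\<rho> \<in> S" if "\<rho> \<in> Poly_Mapping.keys x \<union> Poly_Mapping.keys y" for \<rho>
    using that assms by (auto simp: supported_def)
  have "\<tau> = \<sigma>"
    using \<sigma> \<tau> assms in_S by (intro inj_onD[OF inj_idx]) auto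
  define c where "c = Poly_Mapping.lookup x \<sigma> / Poly_Mapping.lookup y \<sigma>"
  let ?z = "x - chain_scale c y"
  have z: "\<rho> \<in> Poly_Mapping.keys x \<union> Poly_Mapping.keys y \<and> \<rho> \<noteq> \<sigma>" if "\<rho> \<in> Poly_Mapping.keys ?z" for \<rho>
    using that \<tau> \<open>\<tau> = \<sigma>\<close> by (auto simp: in_keys_iff lookup_minus lookup_chain_scale c_def)
  have "lead ?z < lead x" if nonzero: "?z \<noteq> 0"
  proof -
    obtain \<rho> where \<rho>: "\<rho> \<in> Poly_Mapping.keys ?z" "idx \<rho> = lead ?z"
      using lead_in_keys[OF nonzero] .
    have "idx \<rho> \<le> lead x"
      using z[OF \<rho>(1)] idx_le_lead[of \<rho> x] idx_le_lead[of \<rho> y] assms by auto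
    moreover have "idx \<rho> \<noteq> idx \<sigma>"
      using z[OF \<rho>(1)] \<sigma> in_S inj_onD[OF inj_idx, of \<rho> \<sigma>] by auto
    ultimately show ?thesis using \<rho> \<sigma> by simp
  qed
  with that show thesis by blast
qed

text \<open>The leading simplex of \<open>x\<close> has too large an index to occur in
  \<open>y\<close>, so its coefficient survives the subtraction.\<close>

lemma lead_diff_scale:
  assumes "x \<noteq> 0" "y = 0 \<or> lead y < lead x"
  shows "x - chain_scale c y \<noteq> 0 \<and> lead (x - chain_scale c y) = lead x"
proof -
  let ?z = "x - chain_scale c y"
  obtain \<sigma> where \<sigma>: "\<sigma> \<in> Poly_Mapping.keys x" "idx \<sigma> = lead x"
    using lead_in_keys[OF \<open>x \<noteq> 0\<close>] .
  have "\<sigma> \<notin> Poly_Mapping.keys y"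
    using assms \<sigma> idx_le_lead[of \<sigma> y] by auto
  then have z: "\<sigma> \<in> Poly_Mapping.keys ?z"
    using \<sigma> by (simp add: in_keys_iff lookup_minus lookup_chain_scale)
  then have "?z \<noteq> 0" by auto
  then obtain \<rho> where \<rho>: "\<rho> \<in> Poly_Mapping.keys ?z" "idx \<rho> = lead ?z"
    using lead_in_keys by blast
  then have "\<rho> \<in> Poly_Mapping.keys x \<or> \<rho> \<in> Poly_Mapping.keys y"
    by (auto simp: in_keys_iff lookup_minus lookup_chain_scale)
  then have "lead ?z \<le> lead x"
    using \<rho> assms idx_le_lead[of \<rho> x] idx_le_lead[of \<rho> y] by auto
  moreover have "lead x \<le> lead ?z"
    using idx_le_lead[OF z] \<sigma> by simp
  ultimately show ?thesis using \<open>?z \<noteq> 0\<close> by simp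
qed

text \<open>Elimination by induction on the lead: subtracting a multiple of the element of
  \<open>X\<close> with the same lead gives 0 or a chain of \<open>V\<close> with smaller
  lead.\<close>

lemma span_leads:
  assumes V: "chain.subspace V" "V \<subseteq> supported"
    and X: "X \<subseteq> V" "0 \<notin> X" "leads V \<subseteq> lead ` X"
  shows "chain.span X = V"
proof
  show "chain.span X \<subseteq> V"
    by (rule chain.span_minimal[OF X(1) V(1)])
  show "V \<subseteq> chain.span X"
  proof
    fix x assume "x \<in> V"
    then show "x \<in> chain.span X"
    proof (induction "lead x" arbitrary: x rule: less_induct)
      case less
      show ?case
      proof (cases "x = 0")
        case True
        then show ?thesis by (simp add: chain.span_zero)
      next
        case False
        then have "lead x \<in> leads V" using less.prems by (auto simp: leads_def)
        then obtain y where y: "y \<in> X" "lead x = lead y" using X by auto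
        obtain c where c: "x - chain_scale c y = 0 \<or> lead (x - chain_scale c y) < lead x"
          by (rule lead_cancel[of x y]) (use False less.prems y X V in auto)
        have "x - chain_scale c y \<in> V"
          using less.prems y X V by (intro chain.subspace_diff chain.subspace_scale) auto
        with c less.hyps have "x - chain_scale c y \<in> chain.span X"
          by (auto simp: chain.span_zero)
        moreover have "chain_scale c y \<in> chain.span X"
          using y by (intro chain.span_scale chain.span_base)
        ultimately have "(x - chain_scale c y) + chain_scale c y \<in> chain.span X"
          by (rule chain.span_add)
        then show ?thesis by simp
      qed
    qed
  qed
qed

text \<open>Among the elements with non-zero coefficient take the one with the largest lead. Its
  leading simplex occurs in none of the others, as they have smaller leads, so it cannot cancel.
  Independence and orthogonality both rest on this simplex.\<close>

lemma lead_lincomb: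
  fixes X :: "('a set \<Rightarrow>\<^sub>0 'f::field) set"
  assumes X: "X \<subseteq> supported" "0 \<notin> X" "inj_on lead X" "finite X"
    and c: "{x \<in> X. c x \<noteq> 0} \<noteq> {}"
  obtains x \<sigma> where "x \<in> X" "c x \<noteq> 0" "idx \<sigma> = lead x" "\<And>y. y \<in> X \<Longrightarrow> c y \<noteq> 0 \<Longrightarrow> lead y \<le> lead x"
    "\<sigma> \<in> Poly_Mapping.keys (\<Sum>x\<in>X. chain_scale (c x) x)"
proof -
  let ?Y = "{x \<in> X. c x \<noteq> 0}"
  have "Max (lead ` ?Y) \<in> lead ` ?Y"
    using X c by (intro Max_in) auto
  then obtain x where x: "x \<in> ?Y" "lead x = Max (lead ` ?Y)" by auto
  have max: "lead y \<le> lead x" if "y \<in> X" "c y \<noteq> 0" for y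
    unfolding x using that X by (intro Max_ge) auto
  have "x \<noteq> 0" using x X by auto
  then obtain \<sigma> where \<sigma>: "\<sigma> \<in> Poly_Mapping.keys x" "idx \<sigma> = lead x"
    using lead_in_keys by blast
  have "c y * Poly_Mapping.lookup y \<sigma> = 0" if y: "y \<in> X - {x}" for y
  proof (rule ccontr)
    assume *: "c y * Poly_Mapping.lookup y \<sigma> \<noteq> 0"
    then have "lead x \<le> lead y"
      using idx_le_lead[of \<sigma> y] \<sigma> by (auto simp: in_keys_iff)
    with max[of y] * y have "lead y = lead x" by auto
    with inj_onD[OF X(3) this] y x show False by auto
  qed
  then have "(\<Sum>y\<in>X - {x}. c y * Poly_Mapping.lookup y \<sigma>) = 0"
    by (intro sum.neutral) blast
  then have "(\<Sum>y\<in>X. c y * Poly_Mapping.lookup y \<sigma>) = c x * Poly_Mapping.lookup x \<sigma>"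
    using x X sum.remove[of X x "\<lambda>y. c y * Poly_Mapping.lookup y \<sigma>"] by simp
  then have "\<sigma> \<in> Poly_Mapping.keys (\<Sum>x\<in>X. chain_scale (c x) x)"
    using x \<sigma> by (simp add: in_keys_iff lookup_sum lookup_chain_scale)
  with that x \<sigma> max show thesis by blast
qed

lemma independent_leads:
  assumes "X \<subseteq> supported" "0 \<notin> X" "inj_on lead X" "finite X"
  shows "chain.independent X"
  unfolding chain.dependent_finite[OF assms(4)]
proof clarify
  fix c x assume "(\<Sum>v\<in>X. chain_scale (c v) v) = 0" "x \<in> X" "c x \<noteq> 0"
  moreover from this have "{x \<in> X. c x \<noteq> 0} \<noteq> {}" by blast
  ultimately show False
    using lead_lincomb[OF assms, of c] by (metis empty_iff keys_zero)
qed

text \<open>The simplex that survives in the combination has the largest index, hence the latest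
  entry time, among all simplices of the elements involved. Both sides equal this entry
  time.\<close>

lemma orthogonal_leads:
  fixes X :: "('a set \<Rightarrow>\<^sub>0 'f::field) set"
  assumes X: "X \<subseteq> supported" "0 \<notin> X" "inj_on lead X" "finite X"
  shows "orthogonal_chains \<K> X"
  unfolding orthogonal_chains_def
proof (intro conjI allI)
  fix c :: "_ \<Rightarrow> 'f"
  let ?z = "\<Sum>x\<in>X. chain_scale (c x) x" and ?Y = "{x \<in> X. c x \<noteq> 0}"
  show "chain_level \<K> ?z = max_or_minf (chain_level \<K> ` ?Y)"
  proof (cases "?Y = {}")
    case True
    then have "?z = 0" by (intro sum.neutral) auto
    with True show ?thesis by (simp only: chain_level_def max_or_minf_def) simp
  next
    case False
    from lead_lincomb[OF X False] obtain x \<sigma>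
      where x: "x \<in> X" "c x \<noteq> 0" "idx \<sigma> = lead x"
        and max: "\<And>y. y \<in> X \<Longrightarrow> c y \<noteq> 0 \<Longrightarrow> lead y \<le> lead x"
        and \<sigma>: "\<sigma> \<in> Poly_Mapping.keys ?z" by blast
    have keys_z: "\<exists>y\<in>?Y. \<tau> \<in> Poly_Mapping.keys y" if "\<tau> \<in> Poly_Mapping.keys ?z" for \<tau>
    proof -
      have "(\<Sum>x\<in>X. c x * Poly_Mapping.lookup x \<tau>) \<noteq> 0"
        using that by (simp add: in_keys_iff lookup_sum lookup_chain_scale)
      then obtain y where "y \<in> X" "c y * Poly_Mapping.lookup y \<tau> \<noteq> 0"
        by (meson sum.not_neutral_contains_not_neutral)
      then show ?thesis by (auto simp: in_keys_iff)
    qed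
    have le: "entry_time \<K> \<tau> \<le> entry_time \<K> \<sigma>" if "y \<in> ?Y" "\<tau> \<in> Poly_Mapping.keys y" for y \<tau>
    proof (rule entry_time_mono)
      show "\<tau> \<in> S" using that X by (auto simp: supported_def)
      show "\<sigma> \<in> S" using keys_z[OF \<sigma>] X by (auto simp: supported_def)
      show "idx \<tau> \<le> idx \<sigma>" using idx_le_lead[OF that(2)] max[of y] that x by simp
    qed
    have level: "chain_level \<K> y = Max (entry_time \<K> ` Poly_Mapping.keys y)" if "y \<in> ?Y" for y
      using that X by (auto simp: chain_level_def max_or_minf_def)
    obtain y where y: "y \<in> ?Y" "\<sigma> \<in> Poly_Mapping.keys y" using keys_z[OF \<sigma>] by blast
    have "chain_level \<K> ?z = Max (entry_time \<K> ` Poly_Mapping.keys ?z)"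
      using \<sigma> by (auto simp: chain_level_def max_or_minf_def)
    also have "\<dots> = entry_time \<K> \<sigma>"
      using \<sigma> keys_z le by (intro Max_eqI) auto
    also have "\<dots> = Max (chain_level \<K> ` ?Y)"
    proof (rule Max_eqI[symmetric])
      have le': "chain_level \<K> y \<le> entry_time \<K> \<sigma>" if "y \<in> ?Y" for y
        unfolding level[OF that] using that X le by (intro Max.boundedI) auto
      show "t \<le> entry_time \<K> \<sigma>" if "t \<in> chain_level \<K> ` ?Y" for t
        using that le' by auto
      have "entry_time \<K> \<sigma> \<le> chain_level \<K> y"
        unfolding level[OF y(1)] using y by (intro Max_ge) auto
      with le'[OF y(1)] have "entry_time \<K> \<sigma> = chain_level \<K> y" by simp
      with y show "entry_time \<K> \<sigma> \<in> chain_level \<K> ` ?Y" by blast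
    qed (use X in auto)
    finally show ?thesis using False by (simp only: max_or_minf_def image_is_empty if_False)
  qed
qed (rule X)

lemma orthogonal_basis_leads:
  assumes "set xs \<subseteq> supported" "0 \<notin> set xs" "distinct (map lead xs)" "chain.span (set xs) = V"
  shows "orthogonal_basis \<K> V xs"
  using assms independent_leads[of "set xs"] orthogonal_leads[of "set xs"]
  by (simp add: orthogonal_basis_def distinct_map)

lemma representative_lead:
  assumes "l \<in> leads V"
  defines "x \<equiv> inv_into (V - {0}) lead l"
  shows "x \<in> V" "x \<noteq> 0" "lead x = l"
  using inv_into_into[of l lead "V - {0}"] f_inv_into_f[of l lead "V - {0}"] assms
  by (auto simp: leads_def)

end

section \<open>Existence of singular value decompositions\<close>

lemma subspace_supported: "chain.subspace {x :: 's \<Rightarrow>\<^sub>0 'f::field. Poly_Mapping.keys x \<subseteq> T}"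
  by (rule chain.subspaceI) (use keys_add keys_chain_scale in force)+

lemma subspace_chains: "chain.subspace (chains K q :: ('a set \<Rightarrow>\<^sub>0 'f::field) set)"
  unfolding chains_def by (rule subspace_supported)

lemma subspace_cycles: "chain.subspace (cycles K q :: ('a::linorder set \<Rightarrow>\<^sub>0 'f::field) set)"
proof -
  have "cycles K q = chains K q \<inter> {x :: 'a set \<Rightarrow>\<^sub>0 'f. boundary x = 0}"
    by (auto simp: cycles_def)
  then show ?thesis
    by (simp add: chain.subspace_inter subspace_chains boundary.subspace_kernel)
qed

lemma subspace_boundaries: "chain.subspace (boundaries K q :: ('a::linorder set \<Rightarrow>\<^sub>0 'f::field) set)"
  unfolding boundaries_def by (rule boundary.subspace_image[OF subspace_chains])

lemma boundary_in_cycles: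
  assumes K: "abstract_simplicial_complex K" and x: "x \<in> chains K (q + 1)"
  shows "boundary x \<in> cycles K q"
proof -
  have "\<tau> \<in> K \<and> card \<tau> = q + 1" if \<tau>: "\<tau> \<in> Poly_Mapping.keys (boundary x)" for \<tau>
  proof -
    from \<tau> obtain \<sigma> v where \<sigma>: "\<sigma> \<in> Poly_Mapping.keys x" "v \<in> \<sigma>" "\<tau> = \<sigma> - {v}"
      by (rule keys_boundary)
    have "\<sigma> \<in> {\<sigma> \<in> K. card \<sigma> = q + 1 + 1}"
      using x \<sigma>(1) unfolding chains_def by blast
    then have "\<sigma> \<in> K" and card: "card \<sigma> = q + 2" by simp_all
    then have faces: "\<And>\<tau>. \<tau> \<subseteq> \<sigma> \<Longrightarrow> \<tau> \<noteq> {} \<Longrightarrow> \<tau> \<in> K"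
      using K unfolding abstract_simplicial_complex_def by blast
    \<comment> \<open>The face has \<open>q + 1 > 0\<close> vertices, so it is non-empty and closure
      of \<open>K\<close> under non-empty faces applies.\<close>
    have "card \<tau> = q + 1" using card \<sigma>(2) unfolding \<sigma>(3) by simp
    moreover from this have "\<tau> \<noteq> {}" by auto
    then have "\<tau> \<in> K" using \<sigma>(3) by (intro faces) simp_all
    ultimately show ?thesis by simp
  qed
  then show ?thesis
    by (auto simp: cycles_def chains_def boundary_boundary)
qed

lemma boundaries_subset_cycles:
  "abstract_simplicial_complex K \<Longrightarrow> boundaries K q \<subseteq> cycles K q"
  using boundary_in_cycles by (auto simp: boundaries_def)

text \<open>A column reduction phrased with leads. \<open>ys\<close> lists the minimal lifts
  \<open>Y b\<close>, then one cycle for each lead of a \<open>(q + 1)\<close>-cycle;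
  \<open>xs\<close> lists the boundaries of the lifts, then one cycle for each lead of a
  \<open>q\<close>-cycle that no boundary has.\<close>

lemma (in simplex_index) singular_value_decomposition_exists:
  assumes complex: "abstract_simplicial_complex S"
  shows "\<exists>ys xs :: ('a set \<Rightarrow>\<^sub>0 'f::field) list. singular_value_decomposition S \<K> q ys xs"
proof -
  define C where "C = (chains S (q + 1) :: ('a set \<Rightarrow>\<^sub>0 'f) set)"
  define W where "W = (cycles S q :: ('a set \<Rightarrow>\<^sub>0 'f) set)"
  define Z where "Z = (cycles S (q + 1) :: ('a set \<Rightarrow>\<^sub>0 'f) set)"
  define I where "I = (boundaries S q :: ('a set \<Rightarrow>\<^sub>0 'f) set)"
  have subspaces: "chain.subspace C" "chain.subspace W" "chain.subspace Z" "chain.subspace I"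
    by (simp_all add: C_def W_def Z_def I_def subspace_chains subspace_cycles subspace_boundaries)
  have supp: "C \<subseteq> supported" "W \<subseteq> supported"
    by (auto simp: C_def W_def cycles_def chains_def supported_def)
  have "Z \<subseteq> C" by (auto simp: Z_def C_def cycles_def)
  have "I \<subseteq> W" unfolding I_def W_def by (rule boundaries_subset_cycles[OF complex])
  have supp': "Z \<subseteq> supported" "I \<subseteq> supported"
    using supp \<open>Z \<subseteq> C\<close> \<open>I \<subseteq> W\<close> by auto
  have I_eq: "I = boundary ` C" by (simp add: I_def C_def boundaries_def)
  have Z_iff: "x \<in> Z \<longleftrightarrow> x \<in> C \<and> boundary x = 0" for x by (simp add: Z_def C_def cycles_def)
  \<comment> \<open>Only the lead of the boundary is prescribed, not the boundary itself. A
    candidate therefore stays a candidate after subtracting a chain whose boundary is zero or has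
    smaller lead.\<close>
  define preimage where
    "preimage b y \<longleftrightarrow> y \<in> C \<and> boundary y \<noteq> 0 \<and> lead (boundary y) = b" for b and y :: "'a set \<Rightarrow>\<^sub>0 'f"
  have "\<forall>b\<in>leads I. \<exists>y. preimage b y \<and> (\<forall>y'. preimage b y' \<longrightarrow> lead y \<le> lead y')"
  proof
    fix b assume "b \<in> leads I"
    then obtain y where "preimage b y" by (auto simp: leads_def I_eq preimage_def)
    then show "\<exists>y. preimage b y \<and> (\<forall>y'. preimage b y' \<longrightarrow> lead y \<le> lead y')"
      by (rule ex_has_least_nat)
  qed
  from bchoice[OF this] obtain Y where Y: "\<And>b. b \<in> leads I \<Longrightarrow> preimage b (Y b)"
    and Y_min: "\<And>b y. b \<in> leads I \<Longrightarrow> preimage b y \<Longrightarrow> lead (Y b) \<le> lead y"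
    by blast
  have Y_in: "Y b \<in> C" "boundary (Y b) \<noteq> 0" "lead (boundary (Y b)) = b" if "b \<in> leads I" for b
    using Y[OF that] by (auto simp: preimage_def)
  have Y_nonzero: "Y b \<noteq> 0" if "b \<in> leads I" for b
    using Y_in(2)[OF that] by auto
  \<comment> \<open>Otherwise a multiple of \<open>y\<close> cancels the leading term of
    \<open>Y b\<close>, and the difference is a candidate for \<open>b\<close> with smaller lead.
    The case \<open>boundary y = 0\<close> separates lifts from cycles, the other case separates
    lifts from each other.\<close>
  have lead_Y: "lead y \<noteq> lead (Y b)"
    if b: "b \<in> leads I" and y: "y \<in> C" "y \<noteq> 0" "boundary y = 0 \<or> lead (boundary y) < b" for b y
  proof
    assume eq: "lead y = lead (Y b)"
    obtain c where c: "Y b - chain_scale c y = 0 \<or> lead (Y b - chain_scale c y) < lead (Y b)"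
      by (rule lead_cancel[of "Y b" y]) (use Y_in[OF b] Y_nonzero[OF b] y supp eq in auto)
    have "preimage b (Y b - chain_scale c y)"
      using lead_diff_scale[of "boundary (Y b)" "boundary y" c] Y_in[OF b] y subspaces(1)
      by (auto simp: preimage_def boundary.diff boundary.scale
          intro!: chain.subspace_diff chain.subspace_scale)
    moreover from this have "Y b - chain_scale c y \<noteq> 0" by (auto simp: preimage_def)
    ultimately show False using c Y_min[OF b, of "Y b - chain_scale c y"] by simp
  qed
  have inj_Y: "inj_on (lead \<circ> Y) (leads I)"
  proof (rule linorder_inj_onI')
    fix b b' assume "b \<in> leads I" "b' \<in> leads I" "b < b'"
    then show "(lead \<circ> Y) b \<noteq> (lead \<circ> Y) b'"
      using lead_Y[of b' "Y b"] Y_in[of b] Y_nonzero[of b] by auto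
  qed
  define rep where "rep V = inv_into (V - {0}) lead" for V :: "('a set \<Rightarrow>\<^sub>0 'f) set"
  have rep: "rep V l \<in> V" "rep V l \<noteq> 0" "lead (rep V l) = l" if "l \<in> leads V" for V l
    unfolding rep_def by (rule representative_lead[OF that])+
  define bs where "bs = sorted_list_of_set (leads I)"
  define zs where "zs = map (rep Z) (sorted_list_of_set (leads Z))"
  define us where "us = map (rep W) (sorted_list_of_set (leads W - leads I))"
  define ys where "ys = map Y bs @ zs"
  define xs where "xs = map (boundary \<circ> Y) bs @ us"
  note finite = finite_leads[OF supp(2)] finite_leads[OF supp'(1)] finite_leads[OF supp'(2)]
  have set_bs: "set bs = leads I" by (simp add: bs_def finite)
  have set_zs: "set zs = rep Z ` leads Z" by (simp add: zs_def finite)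
  have set_us: "set us = rep W ` (leads W - leads I)" by (simp add: us_def finite)
  have lead_zs: "map lead zs = sorted_list_of_set (leads Z)"
    unfolding zs_def map_map by (rule map_idI) (simp add: finite rep)
  have lead_us: "map lead us = sorted_list_of_set (leads W - leads I)"
    unfolding us_def map_map by (rule map_idI) (simp add: finite rep)
  have lead_bs: "map lead (map (boundary \<circ> Y) bs) = bs"
    unfolding map_map by (rule map_idI) (simp add: set_bs Y_in)
  have "leads I \<subseteq> leads W" using \<open>I \<subseteq> W\<close> by (auto simp: leads_def)

  have span_I: "chain.span (set (map (boundary \<circ> Y) bs)) = I"
  proof (rule span_leads[OF subspaces(4) supp'(2)])
    show "leads I \<subseteq> lead ` set (map (boundary \<circ> Y) bs)"
      unfolding set_map[symmetric] lead_bs by (simp add: set_bs)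
  qed (auto simp: set_bs I_eq Y_in dest: Y_in(2))
  have basis_I: "orthogonal_basis \<K> I (map (boundary \<circ> Y) bs)"
  proof (rule orthogonal_basis_leads[OF _ _ _ span_I])
    show "set (map (boundary \<circ> Y) bs) \<subseteq> supported"
      using chain.span_superset supp'(2) unfolding span_I[symmetric] by (rule order_trans)
    show "0 \<notin> set (map (boundary \<circ> Y) bs)" by (auto simp: set_bs dest: Y_in(2))
    show "distinct (map lead (map (boundary \<circ> Y) bs))"
      unfolding lead_bs by (simp add: bs_def)
  qed

  have span_Z: "chain.span (set zs) = Z"
    by (rule span_leads[OF subspaces(3) supp'(1)])
      (auto simp: set_zs rep image_image dest: rep(2))
  have basis_Z: "orthogonal_basis \<K> Z zs"
  proof (rule orthogonal_basis_leads[OF _ _ _ span_Z])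
    show "set zs \<subseteq> supported"
      using chain.span_superset supp'(1) unfolding span_Z[symmetric] by (rule order_trans)
    show "0 \<notin> set zs" by (auto simp: set_zs dest: rep(2))
    show "distinct (map lead zs)" unfolding lead_zs by simp
  qed

  have xs_W: "set xs \<subseteq> W"
  proof -
    have "set (map (boundary \<circ> Y) bs) \<subseteq> W"
      using chain.span_superset[of "set (map (boundary \<circ> Y) bs)"] \<open>I \<subseteq> W\<close> unfolding span_I by (rule order_trans)
    then show ?thesis by (auto simp: xs_def set_us rep)
  qed
  have xs_nonzero: "0 \<notin> set xs"
    by (auto simp: xs_def set_bs set_us dest: Y_in(2) rep(2))
  have lead_xs: "map lead xs = bs @ sorted_list_of_set (leads W - leads I)"
    by (simp only: xs_def map_append lead_bs lead_us)
  have span_W: "chain.span (set xs) = W"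
  proof (rule span_leads[OF subspaces(2) supp(2) xs_W xs_nonzero])
    show "leads W \<subseteq> lead ` set xs"
      unfolding set_map[symmetric] lead_xs by (auto simp: set_bs finite)
  qed
  have basis_W: "orthogonal_basis \<K> W xs"
  proof (rule orthogonal_basis_leads[OF _ xs_nonzero _ span_W])
    show "set xs \<subseteq> supported" using xs_W supp by blast
    show "distinct (map lead xs)"
      unfolding lead_xs by (auto simp: set_bs finite) (simp add: bs_def)
  qed

  have ys_C: "set ys \<subseteq> C"
    using \<open>Z \<subseteq> C\<close> by (auto simp: ys_def set_bs set_zs Y_in dest: rep(1))
  \<comment> \<open>Not by leads: every chain \<open>v\<close> has the same boundary as some
    combination \<open>u\<close> of the lifts, and \<open>v - u\<close> is a cycle, hence in the
    span of \<open>zs\<close>.\<close>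
  have span_C: "chain.span (set ys) = C"
  proof
    show "chain.span (set ys) \<subseteq> C" by (rule chain.span_minimal[OF ys_C subspaces(1)])
    show "C \<subseteq> chain.span (set ys)"
    proof
      fix v assume v: "v \<in> C"
      have "boundary ` chain.span (Y ` leads I) = chain.span (set (map (boundary \<circ> Y) bs))"
        by (simp only: boundary.span_image[symmetric] set_map set_bs image_comp)
      then have "I = boundary ` chain.span (Y ` leads I)"
        by (simp only: span_I)
      then obtain u where u: "u \<in> chain.span (Y ` leads I)" "boundary v = boundary u"
        using v I_eq by blast
      have "chain.span (Y ` leads I) \<subseteq> C"
        by (rule chain.span_minimal) (auto simp: Y_in subspaces)
      with u v have "v - u \<in> Z"
        by (auto simp: Z_iff boundary.diff intro: chain.subspace_diff[OF subspaces(1)])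
      then have "v - u \<in> chain.span (set ys)"
        unfolding span_Z[symmetric] using chain.span_mono[of "set zs" "set ys"] by (auto simp: ys_def)
      moreover have "u \<in> chain.span (set ys)"
        using u chain.span_mono[of "Y ` leads I" "set ys"] by (auto simp: ys_def set_bs)
      ultimately have "(v - u) + u \<in> chain.span (set ys)" by (rule chain.span_add)
      then show "v \<in> chain.span (set ys)" by simp
    qed
  qed
  have basis_C: "orthogonal_basis \<K> C ys"
  proof (rule orthogonal_basis_leads[OF _ _ _ span_C])
    show "set ys \<subseteq> supported" using ys_C supp by blast
    show "0 \<notin> set ys" by (auto simp: ys_def set_bs set_zs dest: Y_nonzero rep(2))
    have "lead (Y b) \<notin> leads Z" if b: "b \<in> leads I" for b
      using lead_Y[OF b, of "rep Z (lead (Y b))"] rep[of "lead (Y b)" Z] by (auto simp: Z_iff)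
    then have disjoint: "set (map (lead \<circ> Y) bs) \<inter> leads Z = {}"
      by (auto simp: set_bs)
    have "distinct (map (lead \<circ> Y) bs)"
      using inj_Y by (simp only: distinct_map set_bs) (simp add: bs_def)
    with disjoint show "distinct (map lead ys)"
      by (simp only: ys_def map_append lead_zs map_map distinct_append) (simp add: finite)
  qed

  \<comment> \<open>The definition splits both lists at the dimension of the space of boundaries;
    this has to be the number of lifts.\<close>
  have rank: "boundary_rank TYPE('f) S q = length bs"
  proof -
    have "boundary_rank TYPE('f) S q = card (set (map (boundary \<circ> Y) bs))"
      unfolding boundary_rank_def I_def[symmetric]
      using basis_I chain.dim_eq_card[of "set (map (boundary \<circ> Y) bs)" I]
      by (simp add: orthogonal_basis_def chain.span_eq_iff[THEN iffD2, OF subspaces(4)])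
    also have "\<dots> = length bs"
      using basis_I distinct_card[of "map (boundary \<circ> Y) bs"] by (simp add: orthogonal_basis_def)
    finally show ?thesis .
  qed
  have "singular_value_decomposition S \<K> q ys xs"
    unfolding singular_value_decomposition_def Let_def rank
      C_def[symmetric] W_def[symmetric] Z_def[symmetric] I_def[symmetric]
    using basis_C basis_W basis_Z basis_I
    by (simp add: ys_def xs_def nth_append)
  then show ?thesis by blast
qed

section \<open>Sublevel spaces of a decomposition\<close>

text \<open>Half-lines \<open>{..u}\<close> suffice for the Betti numbers, but isolating a single
  diagram point also takes \<open>{..<u}\<close> and the set of all values other than
  \<infinity>.\<close>

definition downward_closed :: "ereal set \<Rightarrow> bool" where
  "downward_closed A \<longleftrightarrow> (\<forall>a\<in>A. \<forall>b\<le>a. b \<in> A)"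

lemma downward_closed_simps [simp]:
  "downward_closed {..u}" "downward_closed {..<u}" "downward_closed (- {\<infinity>})"
  by (auto simp: downward_closed_def)

text \<open>A condition on the simplices instead of on \<open>chain_level\<close>, so that the zero
  chain belongs even if \<open>A\<close> is empty, and the result is always a subspace when
  \<open>V\<close> is one.\<close>

definition sublevel ::
    "(real \<Rightarrow> 'a set set) \<Rightarrow> ereal set \<Rightarrow> ('a set \<Rightarrow>\<^sub>0 'f::field) set \<Rightarrow> ('a set \<Rightarrow>\<^sub>0 'f) set" where
  "sublevel \<K> A V = {x \<in> V. entry_time \<K> ` Poly_Mapping.keys x \<subseteq> A}"

lemma chain_level_nonzero:
  "x \<noteq> 0 \<Longrightarrow> chain_level \<K> x = Max (entry_time \<K> ` Poly_Mapping.keys x)"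
  by (simp add: chain_level_def max_or_minf_def)

lemma chain_level_in_iff:
  assumes A: "downward_closed A" and x: "x \<noteq> 0"
  shows "chain_level \<K> x \<in> A \<longleftrightarrow> entry_time \<K> ` Poly_Mapping.keys x \<subseteq> A"
proof -
  let ?T = "entry_time \<K> ` Poly_Mapping.keys x"
  have "Max ?T \<in> ?T" using x by (intro Max_in) auto
  moreover have "t \<le> Max ?T" if "t \<in> ?T" for t using that by (intro Max_ge) auto
  ultimately show ?thesis
    using A unfolding chain_level_nonzero[OF x] downward_closed_def by blast
qed

lemma subspace_sublevel:
  assumes "chain.subspace V"
  shows "chain.subspace (sublevel \<K> A V)"
proof -
  have "sublevel \<K> A V = V \<inter> {x. Poly_Mapping.keys x \<subseteq> {\<sigma>. entry_time \<K> \<sigma> \<in> A}}"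
    by (auto simp: sublevel_def)
  then show ?thesis by (simp add: assms chain.subspace_inter subspace_supported)
qed

text \<open>By orthogonality no basis element occurring in a chain has a larger level than the
  chain, so all of them have level in \<open>A\<close> as soon as the chain does.\<close>

lemma sublevel_eq_span:
  fixes V :: "('a set \<Rightarrow>\<^sub>0 'f::field) set"
  assumes basis: "orthogonal_basis \<K> V xs" and A: "downward_closed A"
  shows "sublevel \<K> A V = chain.span {x \<in> set xs. chain_level \<K> x \<in> A}" (is "?L = chain.span ?X")
proof
  have V: "V = chain.span (set xs)" and ind: "chain.independent (set xs)"
    and orth: "\<And>c. chain_level \<K> (\<Sum>x\<in>set xs. chain_scale (c x) x)
            = max_or_minf (chain_level \<K> ` {x \<in> set xs. c x \<noteq> 0})"
    using basis by (auto simp: orthogonal_basis_def orthogonal_chains_def)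
  have nonzero: "x \<noteq> 0" if "x \<in> set xs" for x
    using ind that chain.dependent_zero by blast
  show "chain.span ?X \<subseteq> ?L"
  proof (rule chain.span_minimal)
    show "?X \<subseteq> ?L"
      using nonzero chain_level_in_iff[OF A, where \<K>=\<K>] chain.span_base[of _ "set xs"]
      by (auto simp: sublevel_def V)
    show "chain.subspace ?L" unfolding V by (intro subspace_sublevel chain.subspace_span)
  qed
  show "?L \<subseteq> chain.span ?X"
  proof
    fix x assume x: "x \<in> ?L"
    show "x \<in> chain.span ?X"
    proof (cases "x = 0")
      case False
      have "x \<in> chain.span (set xs)" using x by (simp add: sublevel_def V)
      then obtain c where c: "x = (\<Sum>v\<in>set xs. chain_scale (c v) v)"
        unfolding chain.span_finite[OF finite_set] by blast
      let ?Y = "{v \<in> set xs. c v \<noteq> 0}"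
      have x_Y: "x = (\<Sum>v\<in>?Y. chain_scale (c v) v)"
        unfolding c by (rule sum.mono_neutral_right) auto
      have "?Y \<noteq> {}"
      proof
        assume "?Y = {}"
        with x_Y False show False by (simp only: sum.empty)
      qed
      then have level: "chain_level \<K> x = Max (chain_level \<K> ` ?Y)"
        unfolding c orth by (simp only: max_or_minf_def image_is_empty if_False)
      have in_A: "chain_level \<K> x \<in> A"
        using x False by (simp add: chain_level_in_iff[OF A] sublevel_def)
      have "chain_level \<K> v \<in> A" if "v \<in> ?Y" for v
      proof -
        have "chain_level \<K> v \<le> chain_level \<K> x"
          unfolding level using that by (intro Max_ge) auto
        with A in_A show ?thesis unfolding downward_closed_def by blast
      qed
      then show ?thesis
        unfolding x_Y by (intro chain.span_sum chain.span_scale chain.span_base) auto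
    qed (simp add: chain.span_zero)
  qed
qed

text \<open>Coordinates with respect to \<open>X\<close> are unique, so those of a vector in both
  spans vanish outside \<open>S\<close> and outside \<open>T\<close>.\<close>

lemma span_Int_independent:
  fixes X :: "('s \<Rightarrow>\<^sub>0 'f::field) set"
  assumes X: "chain.independent X" and ST: "S \<subseteq> X" "T \<subseteq> X"
  shows "chain.span S \<inter> chain.span T = chain.span (S \<inter> T)"
proof
  show "chain.span S \<inter> chain.span T \<subseteq> chain.span (S \<inter> T)"
  proof
    fix v assume v: "v \<in> chain.span S \<inter> chain.span T"
    have rep: "chain.representation X v = chain.representation S v"
      "chain.representation X v = chain.representation T v"
      using v ST by (simp_all add: chain.representation_extend[OF X])
    have "v \<in> chain.span X"
      by (rule subsetD[OF chain.span_mono[OF ST(1)]]) (use v in simp)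
    from chain.sum_nonzero_representation_eq[OF X this, symmetric] have "v = (\<Sum>b | chain.representation X v b \<noteq> 0. chain_scale (chain.representation X v b) b)" .
    moreover have "\<dots> \<in> chain.span (S \<inter> T)"
    proof (intro chain.span_sum chain.span_scale chain.span_base)
      fix b assume "b \<in> {b. chain.representation X v b \<noteq> 0}"
      then show "b \<in> S \<inter> T"
        using chain.representation_ne_zero[of S v b] chain.representation_ne_zero[of T v b] rep by simp
    qed
    ultimately show "v \<in> chain.span (S \<inter> T)" by (simp only:)
  qed
qed (auto intro: chain.span_mono[THEN subsetD])

section \<open>Dimension of a sublevel quotient\<close>

lemma size_filter_mset_map_upt:
  "size (filter_mset P (mset (map f [0..<n]))) = card {i. i < n \<and> P (f i)}"
proof -
  have "size (filter_mset P (mset (map f [0..<n]))) = length (filter P (map f [0..<n]))"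
    by (simp only: mset_filter[symmetric] size_mset)
  also have "\<dots> = card {i. i < n \<and> P (f i)}"
    by (simp only: length_filter_conv_card) (intro arg_cong[where f=card], auto)
  finally show ?thesis .
qed

text \<open>Both spaces are spanned by parts of the one independent set \<open>set xs\<close>, so
  the dimension counts the basis elements in the first part but not in the second. The left-hand
  side does not mention the decomposition: this gives the uniqueness of the diagram as well as the
  Betti numbers.\<close>

lemma dim_sublevel_quotient:
  fixes xs ys :: "('a::linorder set \<Rightarrow>\<^sub>0 'f::field) list"
  assumes svd: "singular_value_decomposition K \<K> q ys xs"
    and A: "downward_closed A" and B: "downward_closed B" "\<infinity> \<notin> B"
  shows "vectorspace.dim (class_ring :: 'f ring)
      (quotient_space (sublevel \<K> A (cycles K q))
        (sublevel \<K> A (cycles K q) \<inter> boundary ` sublevel \<K> B (chains K (q + 1)))) =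
    size {#p \<in># svd_diagram K \<K> q ys xs. fst p \<in> A \<and> snd p \<notin> B#}"
proof -
  define \<rho> where "\<rho> = boundary_rank TYPE('f) K q"
  have ys: "orthogonal_basis \<K> (chains K (q + 1)) ys" and xs: "orthogonal_basis \<K> (cycles K q) xs"
    and ker: "orthogonal_basis \<K> (cycles K (q + 1)) (drop \<rho> ys)"
    and im: "orthogonal_basis \<K> (boundaries K q) (take \<rho> xs)"
    and boundary_ys: "\<And>i. i < \<rho> \<Longrightarrow> boundary (ys ! i) = xs ! i"
    using svd by (simp_all add: singular_value_decomposition_def Let_def \<rho>_def)
  have dist: "distinct xs" and ind: "chain.independent (set xs)"
    using xs by (auto simp: orthogonal_basis_def)
  have rank: "\<rho> = chain.dim (boundaries K q :: ('a set \<Rightarrow>\<^sub>0 'f) set)"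
    by (simp add: \<rho>_def boundary_rank_def)
  \<comment> \<open>Comparing dimensions shows that \<open>take\<close> does not truncate, so every
    index below \<open>\<rho>\<close> is valid; for \<open>ys\<close> the same follows because the
    boundaries of its elements span.\<close>
  have "\<rho> = card (set (take \<rho> xs))"
    using im chain.dim_eq_card_independent[of "set (take \<rho> xs)"]
    unfolding rank orthogonal_basis_def by (metis chain.dim_span)
  also have "\<dots> = min \<rho> (length xs)"
    using dist distinct_card[of "take \<rho> xs"] by (simp add: min.commute)
  finally have \<rho>_xs: "\<rho> \<le> length xs" by simp
  have \<rho>_ys: "\<rho> \<le> length ys"
  proof -
    have "boundaries K q = chain.span (boundary ` set ys)"
      using ys unfolding boundary.span_image by (simp add: boundaries_def orthogonal_basis_def)
    then have "\<rho> \<le> card (boundary ` set ys)"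
      unfolding rank by (intro chain.dim_le_card) auto
    also have "\<dots> \<le> length ys"
      using card_image_le[of "set ys" boundary] card_length[of ys] by simp
    finally show ?thesis .
  qed
  define X where "X = {x \<in> set xs. chain_level \<K> x \<in> A}"
  define Y where "Y = {xs ! i | i. i < \<rho> \<and> chain_level \<K> (ys ! i) \<in> B}"
  have "Y \<subseteq> set xs" using \<rho>_xs by (auto simp: Y_def)
  have cycles: "sublevel \<K> A (cycles K q) = chain.span X"
    unfolding X_def by (rule sublevel_eq_span[OF xs A])
  have image: "boundary ` sublevel \<K> B (chains K (q + 1)) = chain.span Y"
  proof -
    let ?Y = "{y \<in> set ys. chain_level \<K> y \<in> B}"
    \<comment> \<open>From index \<open>\<rho>\<close> on, the elements of \<open>ys\<close> are
      cycles and contribute only 0.\<close>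
    have "boundary ` ?Y \<subseteq> insert 0 Y"
    proof (intro image_subsetI)
      fix y assume y: "y \<in> ?Y"
      then obtain i where i: "i < length ys" "y = ys ! i" by (auto simp: in_set_conv_nth)
      show "boundary y \<in> insert 0 Y"
      proof (cases "i < \<rho>")
        case True
        then show ?thesis using y i boundary_ys by (auto simp: Y_def)
      next
        case False
        then have "drop \<rho> ys ! (i - \<rho>) = y" "i - \<rho> < length (drop \<rho> ys)"
          using i by simp_all
        then have "y \<in> set (drop \<rho> ys)" using nth_mem by metis
        then have "y \<in> cycles K (q + 1)"
          using ker chain.span_base[of y "set (drop \<rho> ys)"] by (simp add: orthogonal_basis_def)
        then show ?thesis by (simp add: cycles_def)
      qed
    qed
    moreover have "Y \<subseteq> boundary ` ?Y"
      using \<rho>_ys boundary_ys by (auto simp: Y_def image_iff) (metis nth_mem order_less_le_trans)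
    ultimately have "chain.span (boundary ` ?Y) = chain.span Y"
      using chain.span_mono[of "boundary ` ?Y" "insert 0 Y"] chain.span_mono[of Y "boundary ` ?Y"]
      by (simp add: chain.span_insert_0)
    then show ?thesis
      unfolding sublevel_eq_span[OF ys B(1)] by (simp only: boundary.span_image)
  qed
  have "vectorspace.dim (class_ring :: 'f ring)
      (quotient_space (sublevel \<K> A (cycles K q))
        (sublevel \<K> A (cycles K q) \<inter> boundary ` sublevel \<K> B (chains K (q + 1)))) =
      vectorspace.dim (class_ring :: 'f ring) (quotient_space (chain.span X) (chain.span (X \<inter> Y)))"
    unfolding cycles image using \<open>Y \<subseteq> set xs\<close>
    by (subst span_Int_independent[OF ind]) (auto simp: X_def)
  also have "\<dots> = card (X - (X \<inter> Y))"
  proof (rule dim_quotient_space)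
    show "chain.independent X"
      by (rule chain.independent_mono[OF ind]) (simp add: X_def)
  qed (simp_all add: X_def)
  also have "X - (X \<inter> Y) =
      (!) xs ` {i. i < length xs \<and> chain_level \<K> (xs ! i) \<in> A \<and> \<not> (i < \<rho> \<and> chain_level \<K> (ys ! i) \<in> B)}"
    (is "_ = (!) xs ` ?J")
  proof -
    have eq: "xs ! i = xs ! j \<longleftrightarrow> i = j" if "i < length xs" "j < \<rho>" for i j
      using that \<rho>_xs dist by (simp add: nth_eq_iff_index_eq)
    show ?thesis
    proof (intro equalityI subsetI)
      fix x assume x: "x \<in> X - (X \<inter> Y)"
      then obtain i where i: "i < length xs" "x = xs ! i" by (auto simp: X_def in_set_conv_nth)
      with x show "x \<in> (!) xs ` ?J"
        unfolding X_def Y_def by blast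
    next
      fix x assume "x \<in> (!) xs ` ?J"
      then obtain i where i: "i \<in> ?J" "x = xs ! i" by blast
      then show "x \<in> X - (X \<inter> Y)"
        using eq[of i] by (auto simp: X_def Y_def)
    qed
  qed
  also have "card \<dots> = card ?J"
    by (rule card_image) (use dist in \<open>auto simp: inj_on_def nth_eq_iff_index_eq\<close>)
  \<comment> \<open>For indices from \<open>\<rho>\<close> on the second coordinate is \<infinity>,
    which is not in \<open>B\<close>, so these points are counted exactly when the first coordinate
    is in \<open>A\<close>.\<close>
  also have "\<dots> = size {#p \<in># svd_diagram K \<K> q ys xs. fst p \<in> A \<and> snd p \<notin> B#}"
    unfolding svd_diagram_def size_filter_mset_map_upt using B(2)
    by (intro arg_cong[where f=card]) (auto simp: \<rho>_def)
  finally show ?thesis .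
qed

section \<open>Multisets determined by quadrant counts\<close>

lemma size_filter_mset_split:
  "size (filter_mset P D) = size {#p \<in># D. P p \<and> Q p#} + size {#p \<in># D. P p \<and> \<not> Q p#}"
  by (induction D) auto

text \<open>Differences of quadrant counts isolate first the line of points with first coordinate
  \<open>u\<close>, then a single point on it. For second coordinate \<infinity> one count is
  enough, with \<open>B\<close> the set of all other values.\<close>

lemma multiset_eqI_quadrants:
  fixes D D' :: "(ereal \<times> ereal) multiset"
  assumes eq: "\<And>A B. downward_closed A \<Longrightarrow> downward_closed B \<Longrightarrow> \<infinity> \<notin> B \<Longrightarrow>
      size {#p \<in># D. fst p \<in> A \<and> snd p \<notin> B#} = size {#p \<in># D'. fst p \<in> A \<and> snd p \<notin> B#}"
  shows "D = D'"
proof (rule multiset_eqI)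
  fix p :: "ereal \<times> ereal"
  obtain u v where p: "p = (u, v)" by force
  \<comment> \<open>Obtained from an equation between sums, so the subtraction of natural numbers is
    exact.\<close>
  have strip: "size {#p \<in># E. fst p = u \<and> snd p \<notin> B#} =
      size {#p \<in># E. fst p \<in> {..u} \<and> snd p \<notin> B#} - size {#p \<in># E. fst p \<in> {..<u} \<and> snd p \<notin> B#}"
    for E and B :: "ereal set"
  proof -
    have "size {#p \<in># E. fst p \<in> {..u} \<and> snd p \<notin> B#} =
        size {#p \<in># E. fst p = u \<and> snd p \<notin> B#} + size {#p \<in># E. fst p \<in> {..<u} \<and> snd p \<notin> B#}"
      by (subst size_filter_mset_split[of _ E "\<lambda>p. fst p = u"])
        (intro arg_cong2[where f="(+)"] arg_cong[where f=size] filter_mset_cong; auto)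
    then show ?thesis by simp
  qed
  have strip_eq: "size {#p \<in># D. fst p = u \<and> snd p \<notin> B#} = size {#p \<in># D'. fst p = u \<and> snd p \<notin> B#}"
    if "downward_closed B" "\<infinity> \<notin> B" for B
    unfolding strip using that eq[of "{..u}" B] eq[of "{..<u}" B] by simp
  have count: "count E p = size {#x \<in># E. x = p#}" for E
    by (induction E) auto
  show "count D p = count D' p"
  proof (cases "v = \<infinity>")
    case True
    have "count E p = size {#p \<in># E. fst p = u \<and> snd p \<notin> - {\<infinity>}#}" for E
      unfolding count by (intro arg_cong[where f=size] filter_mset_cong) (auto simp: p True)
    then show ?thesis
      using strip_eq[of "- {\<infinity>}"] by simp
  next
    case False
    have "size {#p \<in># E. fst p = u \<and> snd p \<notin> {..<v}#} =
        count E p + size {#p \<in># E. fst p = u \<and> snd p \<notin> {..v}#}" for E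
      unfolding count
      by (subst size_filter_mset_split[of _ E "\<lambda>x. x = p"])
        (intro arg_cong2[where f="(+)"] arg_cong[where f=size] filter_mset_cong; auto simp: p)
    then have "count E p = size {#p \<in># E. fst p = u \<and> snd p \<notin> {..<v}#}
        - size {#p \<in># E. fst p = u \<and> snd p \<notin> {..v}#}" for E
      by simp
    then show ?thesis
      using False strip_eq[of "{..<v}"] strip_eq[of "{..v}"] by simp
  qed
qed

text \<open>The quadrant counts of any two decompositions are the same dimensions of quotients, and
  these counts determine the multiset.\<close>

lemma verbose_diagram_eq:
  fixes xs ys :: "('a::linorder set \<Rightarrow>\<^sub>0 'f::field) list"
  assumes "singular_value_decomposition K \<K> q ys xs"
  shows "verbose_diagram TYPE('f) K \<K> q = svd_diagram K \<K> q ys xs"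
  unfolding verbose_diagram_def
proof (rule the_equality)
  fix D
  assume "\<exists>ys xs :: ('a set \<Rightarrow>\<^sub>0 'f) list.
    singular_value_decomposition K \<K> q ys xs \<and> D = svd_diagram K \<K> q ys xs"
  then obtain ys' xs' :: "('a set \<Rightarrow>\<^sub>0 'f) list" where svd':
    "singular_value_decomposition K \<K> q ys' xs'" and D: "D = svd_diagram K \<K> q ys' xs'" by blast
  show "D = svd_diagram K \<K> q ys xs"
    unfolding D
  proof (rule multiset_eqI_quadrants)
    fix A B assume AB: "downward_closed A" "downward_closed B" "\<infinity> \<notin> B"
    show "size {#p \<in># svd_diagram K \<K> q ys' xs'. fst p \<in> A \<and> snd p \<notin> B#} =
        size {#p \<in># svd_diagram K \<K> q ys xs. fst p \<in> A \<and> snd p \<notin> B#}"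
      by (rule trans[OF dim_sublevel_quotient[OF svd' AB, symmetric] dim_sublevel_quotient[OF assms AB]])
  qed
qed (use assms in blast)

section \<open>The verbose measure\<close>

lemma countably_additive_sum_indicator:
  "countably_additive M (\<lambda>B. \<Sum>p\<in>#D. indicator B p :: ennreal)"
proof (rule countably_additiveI)
  fix F :: "nat \<Rightarrow> 'a set" assume F: "disjoint_family F"
  show "suminf (\<lambda>i. \<Sum>p\<in>#D. indicator (F i) p :: ennreal) = (\<Sum>p\<in>#D. indicator (\<Union>i. F i) p)"
    by (induction D) (simp_all add: suminf_add[symmetric] suminf_indicator[OF F])
qed

lemma sum_mset_indicator:
  "(\<Sum>p\<in>#D. indicator B p :: 'b::semiring_1) = of_nat (size {#p \<in># D. p \<in> B#})"
  by (induction D) auto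

text \<open>\<open>measure_of\<close> returns the given set function only if it is a measure on the
  generated \<sigma>-algebra. The generator is already a \<sigma>-algebra, and additivity reduces to
  that of single Dirac measures.\<close>

lemma emeasure_verbose_measure:
  fixes F :: "'f::field itself"
  assumes B: "B \<in> sets (restrict_space borel Delta')"
  shows "emeasure (verbose_measure F K \<K> q) B = of_nat (size {#p \<in># verbose_diagram F K \<K> q. p \<in> B#})"
proof -
  let ?R = "restrict_space borel Delta'"
  have sub: "sets ?R \<subseteq> Pow Delta'"
    using sets.space_closed[of ?R] by (simp add: space_restrict_space)
  have sets: "sets (verbose_measure F K \<K> q) = sets ?R"
    unfolding verbose_measure_def sets_measure_of[OF sub]
    using sets.sigma_sets_eq[of ?R] by (simp add: space_restrict_space)
  have "emeasure (verbose_measure F K \<K> q) B = (\<Sum>p\<in>#verbose_diagram F K \<K> q. indicator B p)"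
    by (rule emeasure_measure_of[OF verbose_measure_def sub])
      (auto simp: sets B positive_def countably_additive_sum_indicator)
  also have "\<dots> = of_nat (size {#p \<in># verbose_diagram F K \<K> q. p \<in> B#})"
    by (rule sum_mset_indicator)
  finally show ?thesis .
qed

lemma rectangle_in_sets:
  "({0..ereal r} \<times> {ereal s<..\<infinity>}) \<inter> Delta' \<in> sets (restrict_space borel Delta')"
proof -
  \<comment> \<open>Written without its top end point, the interval is visibly open in
    \<open>ereal\<close>.\<close>
  have "{ereal s<..\<infinity>} = {ereal s<..}" by auto
  then have "{0..ereal r} \<times> {ereal s<..\<infinity>} \<in> sets (borel \<Otimes>\<^sub>M borel)"
    by (intro pair_measureI) (simp_all only: borel_closed[OF closed_atLeastAtMost] borel_open[OF open_greaterThan])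
  then have "{0..ereal r} \<times> {ereal s<..\<infinity>} \<in> sets borel"
    by (simp only: borel_prod)
  then show ?thesis
    unfolding sets_restrict_space by (subst Int_commute) (rule imageI)
qed

section \<open>Filtrations\<close>

locale finite_filtration =
  fixes K :: "'a::linorder set set" and \<K> :: "real \<Rightarrow> 'a set set"
  assumes complex: "abstract_simplicial_complex K"
    and finite_K: "finite K"
    and filtration: "simplicial_filtration K \<K>"
    and exhaustive: "K = (\<Union>t\<in>{0..}. \<K> t)"
begin

lemma filtration_mono: "0 \<le> r \<Longrightarrow> r \<le> s \<Longrightarrow> \<K> r \<subseteq> \<K> s"
  using filtration unfolding simplicial_filtration_def by blast

lemma entry_time_le: "0 \<le> t \<Longrightarrow> \<sigma> \<in> \<K> t \<Longrightarrow> entry_time \<K> \<sigma> \<le> ereal t"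
  unfolding entry_time_def by (rule Inf_lower) blast

text \<open>Right-continuity makes the infimum attained: a simplex with entry time at most
  \<open>t\<close> lies in every later complex, hence in their intersection
  \<open>\<K> t\<close>.\<close>

lemma mem_filtration_iff:
  assumes t: "0 \<le> t"
  shows "\<sigma> \<in> \<K> t \<longleftrightarrow> \<sigma> \<in> K \<and> entry_time \<K> \<sigma> \<le> ereal t"
proof
  assume "\<sigma> \<in> \<K> t"
  with t exhaustive show "\<sigma> \<in> K \<and> entry_time \<K> \<sigma> \<le> ereal t"
    using entry_time_le by auto
next
  assume le: "\<sigma> \<in> K \<and> entry_time \<K> \<sigma> \<le> ereal t"
  have "\<sigma> \<in> \<K> s" if "t < s" for s
  proof -
    have "entry_time \<K> \<sigma> < ereal s"
      using le that le_less_trans[of "entry_time \<K> \<sigma>" "ereal t" "ereal s"] by simp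
    then obtain t' where "0 \<le> t'" "\<sigma> \<in> \<K> t'" "t' < s"
      unfolding entry_time_def Inf_less_iff by auto
    then show ?thesis using filtration_mono[of t' s] by auto
  qed
  moreover have "\<K> t = (\<Inter>s\<in>{t<..}. \<K> s)"
    using filtration t unfolding simplicial_filtration_def by blast
  ultimately show "\<sigma> \<in> \<K> t" by blast
qed

lemma entry_time_nonneg: "0 \<le> entry_time \<K> \<sigma>"
  unfolding entry_time_def by (rule Inf_greatest) auto

lemma entry_time_finite:
  assumes "\<sigma> \<in> K"
  shows "entry_time \<K> \<sigma> < \<infinity>"
proof -
  from assms exhaustive obtain t where "0 \<le> t" "\<sigma> \<in> \<K> t" by auto
  then have "entry_time \<K> \<sigma> \<le> ereal t" by (rule entry_time_le)
  then show ?thesis by (rule le_less_trans) simp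
qed

lemma entry_time_face:
  assumes "\<tau> \<subseteq> \<sigma>" "\<tau> \<noteq> {}"
  shows "entry_time \<K> \<tau> \<le> entry_time \<K> \<sigma>"
  unfolding entry_time_def
proof (rule Inf_superset_mono, safe)
  fix t assume t: "0 \<le> t" "\<sigma> \<in> \<K> t"
  have "abstract_simplicial_complex (\<K> t)"
    using filtration t(1) unfolding simplicial_filtration_def subcomplex_def by blast
  then have "\<tau> \<in> \<K> t"
    using assms t(2) unfolding abstract_simplicial_complex_def by blast
  with t show "\<exists>t'. ereal t = ereal t' \<and> 0 \<le> t' \<and> \<tau> \<in> \<K> t'" by blast
qed

section \<open>Position of the diagram points\<close>

lemma chain_level_nonneg:
  assumes x: "x \<noteq> 0"
  shows "0 \<le> chain_level \<K> x"
  unfolding chain_level_nonzero[OF x] using x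
  by (subst Max_ge_iff) (auto simp: entry_time_nonneg ex_in_conv)

lemma chain_level_finite:
  assumes x: "x \<noteq> 0" "x \<in> chains K q"
  shows "chain_level \<K> x < \<infinity>"
proof -
  have "entry_time \<K> \<sigma> < \<infinity>" if "\<sigma> \<in> Poly_Mapping.keys x" for \<sigma>
    using that x(2) by (intro entry_time_finite) (auto simp: chains_def)
  then show ?thesis
    unfolding chain_level_nonzero[OF x(1)] using x(1) by (subst Max_less_iff) auto
qed

text \<open>Faces enter no later than the simplices they bound. This places the finite points of the
  diagram on or above the diagonal.\<close>

lemma chain_level_boundary_le:
  assumes nonzero: "boundary x \<noteq> 0"
  shows "chain_level \<K> (boundary x) \<le> chain_level \<K> x"
proof -
  have "x \<noteq> 0" using nonzero by auto
  have "entry_time \<K> \<tau> \<le> chain_level \<K> x" if \<tau>: "\<tau> \<in> Poly_Mapping.keys (boundary x)" for \<tau>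
  proof -
    from \<tau> obtain \<sigma> v where \<sigma>: "\<sigma> \<in> Poly_Mapping.keys x" "v \<in> \<sigma>" "1 < card \<sigma>" "\<tau> = \<sigma> - {v}"
      by (rule keys_boundary)
    then have "card \<tau> \<noteq> 0" by simp
    then have "\<tau> \<noteq> {}" by auto
    then have "entry_time \<K> \<tau> \<le> entry_time \<K> \<sigma>"
      using \<sigma> by (intro entry_time_face) auto
    also have "\<dots> \<le> chain_level \<K> x"
      unfolding chain_level_nonzero[OF \<open>x \<noteq> 0\<close>] using \<sigma> by (intro Max_ge) auto
    finally show ?thesis .
  qed
  then show ?thesis
    unfolding chain_level_nonzero[OF nonzero] using nonzero by (intro Max.boundedI) auto
qed

text \<open>The measure lives on \<open>Delta'\<close>, so this guarantees that no point of the
  diagram is lost. Finite first coordinates exclude the corner at infinity.\<close>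

lemma svd_diagram_subset_Delta':
  fixes xs ys :: "('a set \<Rightarrow>\<^sub>0 'f::field) list"
  assumes svd: "singular_value_decomposition K \<K> q ys xs"
  shows "set_mset (svd_diagram K \<K> q ys xs) \<subseteq> Delta'"
proof -
  have "(chain_level \<K> (xs ! i),
      if i < boundary_rank TYPE('f) K q then chain_level \<K> (ys ! i) else \<infinity>) \<in> Delta'"
    if i: "i < length xs" for i
  proof -
    have ind: "chain.independent (set xs)" and span: "chain.span (set xs) = cycles K q"
      using svd by (simp_all add: singular_value_decomposition_def Let_def orthogonal_basis_def)
    have "xs ! i \<in> cycles K q"
      using i span chain.span_base[of "xs ! i" "set xs"] by simp
    then have chain: "xs ! i \<in> chains K q" by (simp add: cycles_def)
    have nonzero: "xs ! i \<noteq> 0"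
      using ind i chain.dependent_zero[of "set xs"] nth_mem by metis
    have "chain_level \<K> (xs ! i) \<le> chain_level \<K> (ys ! i)" if "i < boundary_rank TYPE('f) K q"
      using that svd nonzero chain_level_boundary_le[of "ys ! i"]
      by (simp add: singular_value_decomposition_def Let_def)
    with chain_level_nonneg[OF nonzero] chain_level_finite[OF nonzero chain] show ?thesis
      by (auto simp: Delta'_def)
  qed
  then show ?thesis by (auto simp: svd_diagram_def)
qed

text \<open>The index of a simplex is its position in a list of all simplices sorted by entry
  time.\<close>

lemma simplex_index_exists: "\<exists>idx. simplex_index \<K> K idx"
proof -
  obtain L0 where L0: "set L0 = K" "distinct L0"
    using finite_distinct_list[OF finite_K] by blast
  define L where "L = sort_key (entry_time \<K>) L0"
  have L: "set L = K" "distinct L" "sorted (map (entry_time \<K>) L)"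
    using L0 by (simp_all add: L_def)
  define idx where "idx = inv_into {..<length L} ((!) L)"
  have idx: "idx \<sigma> < length L" "L ! idx \<sigma> = \<sigma>" if "\<sigma> \<in> K" for \<sigma>
  proof -
    have "\<sigma> \<in> (!) L ` {..<length L}"
      using that L(1) by (auto simp: in_set_conv_nth)
    from inv_into_into[OF this] f_inv_into_f[OF this]
    show "idx \<sigma> < length L" "L ! idx \<sigma> = \<sigma>" by (simp_all add: idx_def)
  qed
  have "simplex_index \<K> K idx"
  proof
    show "inj_on idx K" by (rule inj_onI) (metis idx(2))
    fix \<sigma> \<tau> assume *: "\<sigma> \<in> K" "\<tau> \<in> K" "idx \<sigma> \<le> idx \<tau>"
    show "entry_time \<K> \<sigma> \<le> entry_time \<K> \<tau>"
      using sorted_nth_mono[OF L(3) *(3)] idx[OF *(1)] idx[OF *(2)] by simp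
  qed (rule finite_K)
  then show ?thesis by blast
qed

section \<open>Betti numbers as dimensions of sublevel quotients\<close>

lemma chains_filtration: "0 \<le> t \<Longrightarrow> chains (\<K> t) q = sublevel \<K> {..ereal t} (chains K q)"
  by (auto simp: chains_def sublevel_def mem_filtration_iff subset_iff)

lemma cycles_filtration: "0 \<le> t \<Longrightarrow> cycles (\<K> t) q = sublevel \<K> {..ereal t} (cycles K q)"
  unfolding cycles_def chains_filtration by (auto simp: sublevel_def)

text \<open>The down-sets for \<open>r\<close> and \<open>s\<close> are chosen independently of each
  other, which covers \<open>r > s\<close> as well.\<close>

lemma persistent_betti_eq:
  fixes xs ys :: "('a set \<Rightarrow>\<^sub>0 'f::field) list"
  assumes svd: "singular_value_decomposition K \<K> q ys xs" and "0 \<le> r" "0 \<le> s"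
  shows "persistent_betti TYPE('f) \<K> q r s =
    size {#p \<in># svd_diagram K \<K> q ys xs. fst p \<in> {..ereal r} \<and> snd p \<notin> {..ereal s}#}"
  unfolding persistent_betti_def boundaries_def cycles_filtration[OF \<open>0 \<le> r\<close>]
    chains_filtration[OF \<open>0 \<le> s\<close>]
  by (rule dim_sublevel_quotient[OF svd]) simp_all

end

theorem proposition4p8:
  fixes K :: "'a::linorder set set"
    and \<K> :: "real \<Rightarrow> 'a set set"
    and q :: nat
    and r s :: real
  assumes "abstract_simplicial_complex K"
    and "finite K"
    and "simplicial_filtration K \<K>"
    and "K = (\<Union>t\<in>{0..}. \<K> t)"
    and "0 \<le> r"
    and "0 \<le> s"
  shows "of_nat (persistent_betti TYPE('f::field) \<K> q r s) =
    emeasure (verbose_measure TYPE('f) K \<K> q) (({0..ereal r} \<times> {ereal s<..\<infinity>}) \<inter> Delta')"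
proof -
  interpret finite_filtration K \<K>
    using assms(1-4) by (rule finite_filtration.intro)
  obtain idx where "simplex_index \<K> K idx"
    using simplex_index_exists by blast
  then obtain ys xs :: "('a set \<Rightarrow>\<^sub>0 'f) list"
    where svd: "singular_value_decomposition K \<K> q ys xs"
    using simplex_index.singular_value_decomposition_exists[OF _ complex] by blast
  let ?D = "svd_diagram K \<K> q ys xs" and ?R = "({0..ereal r} \<times> {ereal s<..\<infinity>}) \<inter> Delta'"
  \<comment> \<open>Diagram points lie in \<open>Delta'\<close>, where the first coordinate is at
    least 0, so the quadrant and the rectangle contain the same ones.\<close>
  have "{#p \<in># ?D. fst p \<in> {..ereal r} \<and> snd p \<notin> {..ereal s}#} = {#p \<in># ?D. p \<in> ?R#}"
  proof (rule filter_mset_cong[OF refl])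
    fix p assume "p \<in># ?D"
    then have "p \<in> Delta'" using svd_diagram_subset_Delta'[OF svd] by blast
    then show "(fst p \<in> {..ereal r} \<and> snd p \<notin> {..ereal s}) = (p \<in> ?R)"
      by (auto simp: Delta'_def)
  qed
  then show ?thesis
    unfolding emeasure_verbose_measure[OF rectangle_in_sets] verbose_diagram_eq[OF svd]
      persistent_betti_eq[OF svd assms(5,6)]
    by simp
qed

end
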